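(* Let $T$ be a locally finite tree and let $G \in \mathcal{S}$ be a compactly generated closed subgroup of $\mathrm{Aut}(T)$ satisfying Tits' independence property. Then $G$ is not rigid.
   Context: $\mathrm{Aut}(T)$ carries the permutation topology: a subgroup is open iff it contains the pointwise stabiliser of some finite subset of $T$. $\mathcal{S}$ denotes the class of non-discrete totally disconnected locally compact groups which are topologically simple. A group $G \in \mathcal{S}$ is called rigid if every isomorphism (of topological groups) between two compact open subgroups of $G$ extends to a unique automorphism of the topological group $G$. Tits' independence property for $G \leq \mathrm{Aut}(T)$: for every (finite or infinite) chain (path) $C$ of $T$, let $F$ be the pointwise stabiliser of $C$ in $G$; for each vertex $v$ of $T$ let $\pi(v)$ be the vertex of $C$ closest to $v$; for $c \in V(C)$ the set $\pi^{-1}(c)$ is $F$-invariant, and $F_c$ denotes the permutation group obtained by restricting the action of $F$ to $\pi^{-1}(c)$. The property requires that for every such $C$ the natural homomorphism $F \to \prod_{c \in V(C)} F_c$ is an isomorphism. *)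

theory Defs
  imports
    "HOL-Analysis.Analysis"
    "HOL-Algebra.Bij"
    "HOL-Algebra.Generated_Groups"
    "HOL-Algebra.Product_Groups"
begin

section \<open>Trees\<close>

text \<open>Graphs are simple and undirected, given by a vertex set and an adjacency relation.
  They may be infinite.\<close>

locale simple_graph =
  fixes V :: "'v set" and E :: "'v \<Rightarrow> 'v \<Rightarrow> bool"
  assumes adj_in_verts: "E x y \<Longrightarrow> x \<in> V \<and> y \<in> V"
    and adj_irrefl: "\<not> E x x"
    and adj_sym: "E x y \<Longrightarrow> E y x"

definition walk :: "'v set \<Rightarrow> ('v \<Rightarrow> 'v \<Rightarrow> bool) \<Rightarrow> 'v list \<Rightarrow> bool" where
  "walk V E xs \<longleftrightarrow> xs \<noteq> [] \<and> set xs \<subseteq> V \<and> successively E xs"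

definition graph_cycle :: "'v set \<Rightarrow> ('v \<Rightarrow> 'v \<Rightarrow> bool) \<Rightarrow> 'v list \<Rightarrow> bool" where
  "graph_cycle V E xs \<longleftrightarrow> walk V E xs \<and> distinct xs \<and> length xs \<ge> 3 \<and> E (last xs) (hd xs)"

locale graph_tree = simple_graph +
  assumes verts_nonempty: "V \<noteq> {}"
    and graph_connected:
      "\<lbrakk>x \<in> V; y \<in> V\<rbrakk> \<Longrightarrow> \<exists>xs. walk V E xs \<and> hd xs = x \<and> last xs = y"
    and no_cycle: "\<not> graph_cycle V E xs"

locale locally_finite_tree = graph_tree +
  assumes finite_neighbours: "x \<in> V \<Longrightarrow> finite {y. E x y}"

definition graph_dist :: "'v set \<Rightarrow> ('v \<Rightarrow> 'v \<Rightarrow> bool) \<Rightarrow> 'v \<Rightarrow> 'v \<Rightarrow> nat" where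
  "graph_dist V E x y =
     (LEAST n. \<exists>xs. walk V E xs \<and> hd xs = x \<and> last xs = y \<and> length xs = Suc n)"

text \<open>A chain is the vertex set of a non-empty path without repeated vertices. Intervals of
  the integers as index sets cover finite, one-way infinite and two-way infinite paths.\<close>

definition chain_in :: "'v set \<Rightarrow> ('v \<Rightarrow> 'v \<Rightarrow> bool) \<Rightarrow> 'v set \<Rightarrow> bool" where
  "chain_in V E C \<longleftrightarrow>
     (\<exists>(I :: int set) p.
        I \<noteq> {} \<and> (\<forall>i\<in>I. \<forall>j\<in>I. {i..j} \<subseteq> I) \<and>
        inj_on p I \<and> (\<forall>i. i \<in> I \<and> i + 1 \<in> I \<longrightarrow> E (p i) (p (i + 1))) \<and>
        C = p ` I \<and> C \<subseteq> V)"

section \<open>The automorphism group and the permutation topology\<close>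

text \<open>Automorphisms are elements of \<^const>\<open>BijGroup\<close>, i.e. they are \<^const>\<open>undefined\<close>
  outside \<open>V\<close>, so that equality of functions is equality of automorphisms.\<close>

definition aut_group :: "'v set \<Rightarrow> ('v \<Rightarrow> 'v \<Rightarrow> bool) \<Rightarrow> ('v \<Rightarrow> 'v) monoid" where
  "aut_group V E =
     BijGroup V \<lparr>carrier := {g \<in> Bij V. \<forall>x\<in>V. \<forall>y\<in>V. E (g x) (g y) \<longleftrightarrow> E x y}\<rparr>"

definition pointwise_stabiliser :: "('v \<Rightarrow> 'v) set \<Rightarrow> 'v set \<Rightarrow> ('v \<Rightarrow> 'v) set" where
  "pointwise_stabiliser H A = {g \<in> H. \<forall>x\<in>A. g x = x}"

text \<open>The set of \<open>h\<close> agreeing with \<open>g\<close> on \<open>A\<close> is the left coset of \<open>g\<close> modulo the pointwise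
  stabiliser of \<open>A\<close>; these cosets, for finite \<open>A\<close>, form a base of the topology.\<close>

definition permutation_topology ::
    "'v set \<Rightarrow> ('v \<Rightarrow> 'v \<Rightarrow> bool) \<Rightarrow> ('v \<Rightarrow> 'v) topology" where
  "permutation_topology V E = topology (\<lambda>U. U \<subseteq> carrier (aut_group V E) \<and>
     (\<forall>g\<in>U. \<exists>A. finite A \<and> A \<subseteq> V \<and>
        {h \<in> carrier (aut_group V E). \<forall>x\<in>A. h x = g x} \<subseteq> U))"

lemma openin_permutation_topology:
  "openin (permutation_topology V E) U \<longleftrightarrow> U \<subseteq> carrier (aut_group V E) \<and>
     (\<forall>g\<in>U. \<exists>A. finite A \<and> A \<subseteq> V \<and>
        {h \<in> carrier (aut_group V E). \<forall>x\<in>A. h x = g x} \<subseteq> U)"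
proof -
  let ?G = "carrier (aut_group V E)"
  let ?N = "\<lambda>g A. {h \<in> ?G. \<forall>x\<in>A. h x = g x}"
  let ?P = "\<lambda>U. U \<subseteq> ?G \<and> (\<forall>g\<in>U. \<exists>A. finite A \<and> A \<subseteq> V \<and> ?N g A \<subseteq> U)"
  have Int: "?P (S \<inter> T)" if S: "?P S" and T: "?P T" for S T
  proof (intro conjI ballI)
    show "S \<inter> T \<subseteq> ?G" using S by blast
    fix g assume "g \<in> S \<inter> T"
    then have "g \<in> S" "g \<in> T" by simp_all
    obtain A where A: "finite A" "A \<subseteq> V" "?N g A \<subseteq> S"
      using bspec[OF conjunct2[OF S] \<open>g \<in> S\<close>] by (elim exE conjE)
    obtain B where B: "finite B" "B \<subseteq> V" "?N g B \<subseteq> T"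
      using bspec[OF conjunct2[OF T] \<open>g \<in> T\<close>] by (elim exE conjE)
    have "?N g (A \<union> B) \<subseteq> ?N g A \<inter> ?N g B" by blast
    then have "?N g (A \<union> B) \<subseteq> S \<inter> T" using A(3) B(3) by (meson Int_mono subset_trans)
    moreover have "finite (A \<union> B)" "A \<union> B \<subseteq> V" using A B by simp_all
    ultimately show "\<exists>A. finite A \<and> A \<subseteq> V \<and> ?N g A \<subseteq> S \<inter> T" by (intro exI conjI)
  qed
  have Un: "?P (\<Union>K)" if K: "\<forall>S\<in>K. ?P S" for K
  proof (intro conjI ballI)
    show "\<Union>K \<subseteq> ?G" using K by blast
    fix g assume "g \<in> \<Union>K"
    then obtain S where "S \<in> K" "g \<in> S" by blast
    have "\<exists>A. finite A \<and> A \<subseteq> V \<and> ?N g A \<subseteq> S"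
      using bspec[OF conjunct2[OF bspec[OF K \<open>S \<in> K\<close>]] \<open>g \<in> S\<close>] .
    then obtain A where A: "finite A" "A \<subseteq> V" "?N g A \<subseteq> S" by (elim exE conjE)
    have "?N g A \<subseteq> \<Union>K" using A(3) \<open>S \<in> K\<close> by (meson Union_upper subset_trans)
    with A(1,2) show "\<exists>A. finite A \<and> A \<subseteq> V \<and> ?N g A \<subseteq> \<Union>K" by (intro exI conjI)
  qed
  have "\<forall>S T. ?P S \<longrightarrow> ?P T \<longrightarrow> ?P (S \<inter> T)"
    by (intro allI impI Int)
  moreover have "\<forall>K. (\<forall>S\<in>K. ?P S) \<longrightarrow> ?P (\<Union>K)"
    by (intro allI impI Un)
  ultimately have "istopology ?P"
    unfolding istopology_def by (rule conjI)
  then show ?thesis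
    unfolding permutation_topology_def by (simp only: topology_inverse')
qed

lemma topspace_permutation_topology [simp]:
  "topspace (permutation_topology V E) = carrier (aut_group V E)"
proof (rule antisym)
  show "topspace (permutation_topology V E) \<subseteq> carrier (aut_group V E)"
    using openin_permutation_topology openin_topspace by blast
  have "openin (permutation_topology V E) (carrier (aut_group V E))"
    unfolding openin_permutation_topology by auto
  then show "carrier (aut_group V E) \<subseteq> topspace (permutation_topology V E)"
    by (rule openin_subset)
qed

lemma carrier_aut_group:
  "carrier (aut_group V E) = {g \<in> Bij V. \<forall>x\<in>V. \<forall>y\<in>V. E (g x) (g y) \<longleftrightarrow> E x y}"
  by (simp add: aut_group_def)

lemma subgroup_aut_group: "subgroup (carrier (aut_group V E)) (BijGroup V)"
proof -
  interpret group "BijGroup V" by (rule group_BijGroup)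
  show ?thesis
  proof (rule subgroupI)
    show "carrier (aut_group V E) \<subseteq> carrier (BijGroup V)"
      by (auto simp: carrier_aut_group BijGroup_def)
    have "(\<lambda>x\<in>V. x) \<in> carrier (aut_group V E)"
      by (simp add: carrier_aut_group id_Bij)
    then show "carrier (aut_group V E) \<noteq> {}" by blast
  next
    fix g assume g: "g \<in> carrier (aut_group V E)"
    then have gB: "g \<in> Bij V" by (simp add: carrier_aut_group)
    then have b: "bij_betw g V V" by (simp add: Bij_def)
    have m: "inv_into V g x \<in> V" "g (inv_into V g x) = x" if "x \<in> V" for x
      using b that by (auto simp: bij_betw_def inv_into_into f_inv_into_f)
    have "E (inv_into V g x) (inv_into V g y) \<longleftrightarrow> E x y" if "x \<in> V" "y \<in> V" for x y
    proof -
      have "E (g (inv_into V g x)) (g (inv_into V g y)) \<longleftrightarrow> E (inv_into V g x) (inv_into V g y)"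
        using g m that unfolding carrier_aut_group by blast
      then show ?thesis using m that by simp
    qed
    then show "inv\<^bsub>BijGroup V\<^esub> g \<in> carrier (aut_group V E)"
      using gB by (simp add: carrier_aut_group inv_BijGroup restrict_inv_into_Bij)
  next
    fix g h assume "g \<in> carrier (aut_group V E)" "h \<in> carrier (aut_group V E)"
    then show "g \<otimes>\<^bsub>BijGroup V\<^esub> h \<in> carrier (aut_group V E)"
      by (simp add: carrier_aut_group BijGroup_def compose_Bij compose_eq Bij_imp_funcset[THEN funcset_mem])
  qed
qed

lemma group_aut_group: "group (aut_group V E)"
proof -
  interpret group "BijGroup V" by (rule group_BijGroup)
  have "group (BijGroup V \<lparr>carrier := carrier (aut_group V E)\<rparr>)"
    by (rule subgroup_imp_group[OF subgroup_aut_group])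
  then show ?thesis
    by (simp add: aut_group_def)
qed

lemma mult_aut_group:
  assumes "g \<in> carrier (aut_group V E)" "h \<in> carrier (aut_group V E)"
  shows "g \<otimes>\<^bsub>aut_group V E\<^esub> h = compose V g h"
  using assms by (simp add: aut_group_def BijGroup_def)

text \<open>The usual description of the permutation topology: a subgroup is open iff it contains
  the pointwise stabiliser of a finite set of vertices.\<close>

lemma open_subgroup_permutation_topology_iff:
  assumes H: "subgroup H (aut_group V E)"
  shows "openin (permutation_topology V E) H \<longleftrightarrow>
    (\<exists>A. finite A \<and> A \<subseteq> V \<and> pointwise_stabiliser (carrier (aut_group V E)) A \<subseteq> H)"
proof
  interpret group "aut_group V E" by (rule group_aut_group)
  have one: "\<one>\<^bsub>aut_group V E\<^esub> = (\<lambda>x\<in>V. x)"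
    by (simp add: aut_group_def BijGroup_def)
  let ?G = "carrier (aut_group V E)"
  {
    assume "openin (permutation_topology V E) H"
    then obtain A where A: "finite A" "A \<subseteq> V"
      "{h \<in> ?G. \<forall>x\<in>A. h x = \<one>\<^bsub>aut_group V E\<^esub> x} \<subseteq> H"
      using subgroup.one_closed[OF H] unfolding openin_permutation_topology by blast
    moreover have "\<one>\<^bsub>aut_group V E\<^esub> x = x" if "x \<in> A" for x
      using that A(2) by (auto simp: one)
    ultimately have "pointwise_stabiliser ?G A \<subseteq> H"
      unfolding pointwise_stabiliser_def by force
    with A show "\<exists>A. finite A \<and> A \<subseteq> V \<and> pointwise_stabiliser ?G A \<subseteq> H" by blast
  }
  {
    assume "\<exists>A. finite A \<and> A \<subseteq> V \<and> pointwise_stabiliser ?G A \<subseteq> H"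
    then obtain A where A: "finite A" "A \<subseteq> V" "pointwise_stabiliser ?G A \<subseteq> H" by blast
    have *: "h \<in> H" if g: "g \<in> H" and h: "h \<in> ?G" and eq: "\<forall>x\<in>A. h x = g x" for g h
    proof -
      have gG: "g \<in> ?G" by (rule subgroup.mem_carrier[OF H g])
      have iG: "inv\<^bsub>aut_group V E\<^esub> g \<in> ?G" by (rule inv_closed[OF gG])
      define k where "k = inv\<^bsub>aut_group V E\<^esub> g \<otimes>\<^bsub>aut_group V E\<^esub> h"
      have kG: "k \<in> ?G" unfolding k_def by (rule m_closed[OF iG h])
      have "k x = x" if x: "x \<in> A" for x
      proof -
        have xV: "x \<in> V" using x A(2) by blast
        have "k x = (inv\<^bsub>aut_group V E\<^esub> g) (g x)"
          unfolding k_def mult_aut_group[OF iG h] using xV x eq by (simp add: compose_eq)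
        also have "\<dots> = (inv\<^bsub>aut_group V E\<^esub> g \<otimes>\<^bsub>aut_group V E\<^esub> g) x"
          unfolding mult_aut_group[OF iG gG] using xV by (simp add: compose_eq)
        also have "\<dots> = x"
          unfolding l_inv[OF gG] one using xV by simp
        finally show ?thesis .
      qed
      with kG have "k \<in> pointwise_stabiliser ?G A"
        unfolding pointwise_stabiliser_def by simp
      then have "k \<in> H" by (rule subsetD[OF A(3)])
      then have "g \<otimes>\<^bsub>aut_group V E\<^esub> k \<in> H"
        by (rule subgroup.m_closed[OF H g])
      also have "g \<otimes>\<^bsub>aut_group V E\<^esub> k = h"
        unfolding k_def using gG iG h by (simp add: m_assoc[symmetric])
      finally show ?thesis .
    qed
    show "openin (permutation_topology V E) H"
      unfolding openin_permutation_topology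
    proof (intro conjI ballI)
      show "H \<subseteq> ?G" by (rule subgroup.subset[OF H])
      fix g assume g: "g \<in> H"
      have "{h \<in> ?G. \<forall>x\<in>A. h x = g x} \<subseteq> H" by (rule subsetI, rule *[OF g]) simp_all
      with A(1,2) show "\<exists>A. finite A \<and> A \<subseteq> V \<and> {h \<in> ?G. \<forall>x\<in>A. h x = g x} \<subseteq> H"
        by (intro exI conjI)
    qed
  }
qed

section \<open>Topological groups\<close>

definition topological_group :: "('a, 'b) monoid_scheme \<Rightarrow> 'a topology \<Rightarrow> bool" where
  "topological_group G X \<longleftrightarrow>
     group G \<and> topspace X = carrier G \<and>
     continuous_map (prod_topology X X) X (\<lambda>(x, y). x \<otimes>\<^bsub>G\<^esub> y) \<and>
     continuous_map X X (\<lambda>x. inv\<^bsub>G\<^esub> x)"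

definition totally_disconnected_space :: "'a topology \<Rightarrow> bool" where
  "totally_disconnected_space X \<longleftrightarrow>
     (\<forall>x\<in>topspace X. connected_component_of_set X x = {x})"

definition topologically_simple :: "('a, 'b) monoid_scheme \<Rightarrow> 'a topology \<Rightarrow> bool" where
  "topologically_simple G X \<longleftrightarrow>
     carrier G \<noteq> {\<one>\<^bsub>G\<^esub>} \<and>
     (\<forall>N. N \<lhd> G \<and> closedin X N \<longrightarrow> N = {\<one>\<^bsub>G\<^esub>} \<or> N = carrier G)"

text \<open>The class \<open>\<S>\<close> of non-discrete, totally disconnected, locally compact, topologically
  simple groups; locally compact groups are Hausdorff by convention.\<close>

definition class_S :: "('a, 'b) monoid_scheme \<Rightarrow> 'a topology \<Rightarrow> bool" where
  "class_S G X \<longleftrightarrow>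
     topological_group G X \<and> Hausdorff_space X \<and> locally_compact_space X \<and>
     totally_disconnected_space X \<and> X \<noteq> discrete_topology (carrier G) \<and>
     topologically_simple G X"

definition compactly_generated :: "('a, 'b) monoid_scheme \<Rightarrow> 'a topology \<Rightarrow> bool" where
  "compactly_generated G X \<longleftrightarrow> (\<exists>K. compactin X K \<and> generate G K = carrier G)"

definition compact_open_subgroup ::
    "('a, 'b) monoid_scheme \<Rightarrow> 'a topology \<Rightarrow> 'a set \<Rightarrow> bool" where
  "compact_open_subgroup G X U \<longleftrightarrow> subgroup U G \<and> compactin X U \<and> openin X U"

definition topological_group_iso ::
    "('a, 'c) monoid_scheme \<Rightarrow> 'a topology \<Rightarrow> ('b, 'd) monoid_scheme \<Rightarrow> 'b topology \<Rightarrow>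
     ('a \<Rightarrow> 'b) \<Rightarrow> bool" where
  "topological_group_iso G X H Y \<phi> \<longleftrightarrow> \<phi> \<in> iso G H \<and> homeomorphic_map X Y \<phi>"

text \<open>Elements of \<^const>\<open>auto\<close> are \<^const>\<open>undefined\<close> outside \<open>carrier G\<close>, so uniqueness of
  \<open>\<psi>\<close> below is uniqueness as a map on \<open>carrier G\<close>.\<close>

definition rigid :: "('a, 'b) monoid_scheme \<Rightarrow> 'a topology \<Rightarrow> bool" where
  "rigid G X \<longleftrightarrow>
     (\<forall>U W \<phi>. compact_open_subgroup G X U \<and> compact_open_subgroup G X W \<and>
        topological_group_iso
          (G\<lparr>carrier := U\<rparr>) (subtopology X U) (G\<lparr>carrier := W\<rparr>) (subtopology X W) \<phi> \<longrightarrow>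
        (\<exists>!\<psi>. \<psi> \<in> auto G \<and> homeomorphic_map X X \<psi> \<and> (\<forall>x\<in>U. \<psi> x = \<phi> x)))"

section \<open>Tits' independence property\<close>

definition chain_proj ::
    "'v set \<Rightarrow> ('v \<Rightarrow> 'v \<Rightarrow> bool) \<Rightarrow> 'v set \<Rightarrow> 'v \<Rightarrow> 'v" where
  "chain_proj V E C v = (THE c. is_arg_min (graph_dist V E v) (\<lambda>c. c \<in> C) c)"

definition chain_fibre ::
    "'v set \<Rightarrow> ('v \<Rightarrow> 'v \<Rightarrow> bool) \<Rightarrow> 'v set \<Rightarrow> 'v \<Rightarrow> 'v set" where
  "chain_fibre V E C c = {v \<in> V. chain_proj V E C v = c}"

text \<open>The permutation group induced on a set \<open>B\<close> by a group \<open>F\<close> of permutations leaving \<open>B\<close>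
  invariant.\<close>

definition restricted_group :: "('v \<Rightarrow> 'v) set \<Rightarrow> 'v set \<Rightarrow> ('v \<Rightarrow> 'v) monoid" where
  "restricted_group F B = BijGroup B \<lparr>carrier := (\<lambda>g. restrict g B) ` F\<rparr>"

definition tits_independence ::
    "'v set \<Rightarrow> ('v \<Rightarrow> 'v \<Rightarrow> bool) \<Rightarrow> ('v \<Rightarrow> 'v) set \<Rightarrow> bool" where
  "tits_independence V E H \<longleftrightarrow>
     (\<forall>C. chain_in V E C \<longrightarrow>
        (let F = pointwise_stabiliser H C in
          (\<lambda>g. \<lambda>c\<in>C. restrict g (chain_fibre V E C c)) \<in>
            iso ((aut_group V E)\<lparr>carrier := F\<rparr>)
                (product_group C (\<lambda>c. restricted_group F (chain_fibre V E C c)))))"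

end

theory Submission
  imports Defs
begin

text \<open>
  Call a half-tree \<open>c\<close> fat if arbitrarily small elements of the group are supported in \<open>c\<close>. Suppose
  that a fat \<open>c\<close> has pairwise disjoint translates under the powers of some \<open>\<tau>\<close>, and let \<open>s\<close> be the
  permutation of the vertices which swaps \<open>c\<close> and \<open>\<gamma> c\<close>, for a high power \<open>\<gamma>\<close> of \<open>\<tau>\<close>, and fixes all
  other vertices. It is not a tree automorphism, but by independence conjugation by \<open>s\<close> preserves a
  compact open subgroup. If this isomorphism extended to an automorphism \<open>\<psi>\<close> of the group, then \<open>\<psi> g\<close>
  would agree, up to local symmetries, with \<open>s g s\<^sup>-\<^sup>1\<close>; for \<open>g\<close> a power of \<open>\<tau>\<close> moving everything
  relevant away, \<open>\<psi> g\<close> would change the distance between points of \<open>c\<close> and of a third translate of \<open>c\<close>.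

  To find \<open>c\<close> and \<open>\<tau>\<close>: compact generation and the absence of finite orbits give a translation \<open>\<tau>\<close>
  of some half-tree \<open>h\<close> into itself. Independence and non-discreteness make \<open>h\<close> and its complement
  fat. If no translate of either were contained in a strip \<open>\<tau>\<^sup>-\<^sup>n h - \<tau>\<^sup>n h\<close>, then the stabiliser of the
  edge defining \<open>h\<close> would be a proper non-trivial open normal subgroup.
\<close>

section \<open>Distances and half-trees\<close>

text \<open>For adjacent \<open>x\<close> and \<open>y\<close> this is the component containing
  \<open>y\<close> of the tree without the edge between them. In metric form it is visibly
  equivariant under isometries.\<close>

definition half :: "'v set \<Rightarrow> ('v \<Rightarrow> 'v \<Rightarrow> bool) \<Rightarrow> 'v \<Rightarrow> 'v \<Rightarrow> 'v set" where
  "half V E x y = {v \<in> V. graph_dist V E v y < graph_dist V E v x}"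

context simple_graph
begin

abbreviation dst :: "'v \<Rightarrow> 'v \<Rightarrow> nat" where "dst \<equiv> graph_dist V E"

text \<open>Trades lists for powers of the adjacency relation, so that distances can be treated by
  induction on the exponent.\<close>

lemma walk_iff_relpowp:
  assumes "x \<in> V"
  shows "(\<exists>xs. walk V E xs \<and> hd xs = x \<and> last xs = y \<and> length xs = Suc n) \<longleftrightarrow> (E ^^ n) x y"
  using assms
proof (induction n arbitrary: x)
  case 0
  have "walk V E [x]" using 0 by (simp add: walk_def)
  then show ?case
    by (auto simp: length_Suc_conv intro!: exI[of _ "[x]"])
next
  case (Suc n)
  show ?case
  proof
    assume "\<exists>xs. walk V E xs \<and> hd xs = x \<and> last xs = y \<and> length xs = Suc (Suc n)"
    then obtain xs where xs: "walk V E xs" "hd xs = x" "last xs = y" "length xs = Suc (Suc n)" by blast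
    then obtain z zs where eq: "xs = x # z # zs" by (auto simp: length_Suc_conv)
    have E: "E x z" and w: "walk V E (z # zs)"
      using xs(1) by (auto simp: eq walk_def)
    have "(E ^^ n) z y"
      using Suc.IH[of z] adj_in_verts[OF E] w xs eq by (auto intro!: exI[of _ "z # zs"])
    with E show "(E ^^ Suc n) x y" by (rule relpowp_Suc_I2)
  next
    assume "(E ^^ Suc n) x y"
    then obtain z where E: "E x z" and z: "(E ^^ n) z y" by (rule relpowp_Suc_E2)
    obtain xs where xs: "walk V E xs" "hd xs = z" "last xs = y" "length xs = Suc n"
      using Suc.IH[of z] adj_in_verts[OF E] z by blast
    then have "walk V E (x # xs)"
      using E Suc.prems by (cases xs) (auto simp: walk_def)
    then show "\<exists>xs. walk V E xs \<and> hd xs = x \<and> last xs = y \<and> length xs = Suc (Suc n)"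
      using xs by (intro exI[of _ "x # xs"]) (auto simp: walk_def)
  qed
qed

lemma graph_dist_relpowp: "x \<in> V \<Longrightarrow> dst x y = (LEAST n. (E ^^ n) x y)"
  by (simp add: graph_dist_def walk_iff_relpowp)

lemma relpowp_sym: "(E ^^ n) x y \<Longrightarrow> (E ^^ n) y x"
proof (induction n arbitrary: y)
  case (Suc n)
  then obtain z where "(E ^^ n) x z" "E z y" by (auto elim: relpowp_Suc_E)
  then show ?case using Suc.IH adj_sym by (blast intro: relpowp_Suc_I2)
qed simp

lemma dst_le: "\<lbrakk>x \<in> V; (E ^^ n) x y\<rbrakk> \<Longrightarrow> dst x y \<le> n"
  by (simp add: graph_dist_relpowp Least_le)

lemma half_subset: "half V E x y \<subseteq> V"
  by (auto simp: half_def)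

end

section \<open>The path metric and geodesics\<close>

context graph_tree
begin

lemma relpowp_dst:
  assumes "x \<in> V" "y \<in> V"
  shows "(E ^^ dst x y) x y"
proof -
  obtain xs where xs: "walk V E xs" "hd xs = x" "last xs = y"
    using graph_connected[OF assms] by blast
  then have "length xs = Suc (length xs - 1)" by (cases xs) (auto simp: walk_def)
  with xs have "(E ^^ (length xs - 1)) x y"
    using walk_iff_relpowp[OF assms(1)] by blast
  then show ?thesis
    unfolding graph_dist_relpowp[OF assms(1)] by (rule LeastI)
qed

lemma dst_self [simp]: "x \<in> V \<Longrightarrow> dst x x = 0"
  using dst_le[of x 0 x] by simp

lemma dst_eq_0 [simp]: "\<lbrakk>x \<in> V; y \<in> V\<rbrakk> \<Longrightarrow> dst x y = 0 \<longleftrightarrow> x = y"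
  using relpowp_dst[of x y] by auto

lemma dst_commute: "\<lbrakk>x \<in> V; y \<in> V\<rbrakk> \<Longrightarrow> dst x y = dst y x"
  by (meson dst_le relpowp_dst relpowp_sym antisym)

lemma dst_triangle: "\<lbrakk>x \<in> V; y \<in> V; z \<in> V\<rbrakk> \<Longrightarrow> dst x z \<le> dst x y + dst y z"
  by (meson dst_le relpowp_dst relpowp_trans)

lemma dst_adj: 
  assumes "E x y" shows "dst x y = 1"
proof -
  have V: "x \<in> V" "y \<in> V" using adj_in_verts assms by auto
  have "dst x y \<le> 1" by (rule dst_le) (use V assms in \<open>simp_all add: eq_OO\<close>)
  moreover have "dst x y \<noteq> 0" using V assms adj_irrefl by auto
  ultimately show ?thesis by simp
qed

lemma dst_Suc_step:
  assumes "dst x y = Suc n" "x \<in> V" "y \<in> V"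
  obtains z where "E x z" "z \<in> V" "dst z y = n"
proof -
  have "(E ^^ Suc n) x y" using relpowp_dst assms by metis
  then obtain z where z: "E x z" "(E ^^ n) z y" by (rule relpowp_Suc_E2)
  have zV: "z \<in> V" using adj_in_verts z by blast
  have "dst z y \<le> n" using dst_le zV z by blast
  moreover have "dst x y \<le> 1 + dst z y" using dst_triangle[of x z y] dst_adj[OF z(1)] assms zV by simp
  ultimately show thesis using that z zV assms by simp
qed

text \<open>On a walk of minimal length no two vertices are closer than their indices say, since by
  the triangle inequality this would bring the endpoints closer together.\<close>

lemma geodesic:
  assumes "x \<in> V" "y \<in> V"
  obtains z where "z 0 = x" "z (dst x y) = y" "\<And>i. i < dst x y \<Longrightarrow> E (z i) (z (Suc i))"
    "\<And>i. i \<le> dst x y \<Longrightarrow> z i \<in> V"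
    "\<And>i j. i \<le> j \<Longrightarrow> j \<le> dst x y \<Longrightarrow> dst (z i) (z j) = j - i"
proof -
  define n where "n = dst x y"
  obtain z where z: "z 0 = x" "z n = y" "\<And>i. i < n \<Longrightarrow> E (z i) (z (Suc i))"
    using relpowp_dst[OF assms] by (auto simp: n_def relpowp_fun_conv)
  have V: "z i \<in> V" if "i \<le> n" for i
    using that z(2) assms adj_in_verts[OF z(3), of i] by (cases "i = n") auto
  have le: "dst (z i) (z j) \<le> j - i" if "i \<le> j" "j \<le> n" for i j
    using that
  proof (induction j rule: dec_induct)
    case base then show ?case using V by simp
  next
    case (step k)
    have "dst (z i) (z (Suc k)) \<le> dst (z i) (z k) + dst (z k) (z (Suc k))"
      using step V by (intro dst_triangle) auto
    also have "dst (z k) (z (Suc k)) = 1" using step z by (intro dst_adj) auto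
    finally show ?case using step by simp
  qed
  have "dst (z i) (z j) = j - i" if "i \<le> j" "j \<le> n" for i j
  proof -
    have "n \<le> dst x (z i) + dst (z i) y" 
      unfolding n_def using assms V[of i] that by (intro dst_triangle) auto
    also have "dst (z i) y \<le> dst (z i) (z j) + dst (z j) y"
      using assms V that by (intro dst_triangle) auto
    finally show ?thesis using le[of 0 i] le[of j n] le[of i j] that z by simp
  qed
  then show thesis using that z V by (auto simp: n_def)
qed

section \<open>Acyclicity and the geometry of half-trees\<close>

lemma cycle_contradiction:
  assumes "walk V E xs" "distinct xs" "length xs \<ge> 3" "E (last xs) (hd xs)"
  shows False
  using assms no_cycle unfolding graph_cycle_def by blast

lemma successively_map_upt:
  assumes "\<And>i. \<lbrakk>m \<le> i; Suc i < n\<rbrakk> \<Longrightarrow> P (f i) (f (Suc i))"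
  shows "successively P (map f [m..<n])"
  using assms by (auto simp: successively_conv_nth)

text \<open>Trees are bipartite. Two geodesics of equal length from \<open>v\<close> to the ends of
  an edge either meet again after \<open>v\<close>, which gives a counterexample closer to
  \<open>x\<close>, or close up with the edge to a cycle.\<close>

lemma dst_adj_neq:
  assumes "E x y" "v \<in> V"
  shows "dst v x \<noteq> dst v y"
  using assms(2)
proof (induction "dst v x" arbitrary: v rule: less_induct)
  case less
  have V: "x \<in> V" "y \<in> V" using adj_in_verts assms(1) by auto
  show ?case
  proof
    assume eq: "dst v x = dst v y"
    define n where "n = dst v x"
    obtain p where p: "p 0 = v" "p n = x" "\<And>i. i < n \<Longrightarrow> E (p i) (p (Suc i))"
      "\<And>i. i \<le> n \<Longrightarrow> p i \<in> V" "\<And>i j. i \<le> j \<Longrightarrow> j \<le> n \<Longrightarrow> dst (p i) (p j) = j - i"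
      using geodesic[OF less.prems V(1)] by (auto simp: n_def)
    obtain q where q: "q 0 = v" "q n = y" "\<And>i. i < n \<Longrightarrow> E (q i) (q (Suc i))"
      "\<And>i. i \<le> n \<Longrightarrow> q i \<in> V" "\<And>i j. i \<le> j \<Longrightarrow> j \<le> n \<Longrightarrow> dst (q i) (q j) = j - i"
      using geodesic[OF less.prems V(2)] by (auto simp: n_def eq)
    have n0: "n \<noteq> 0" using eq less.prems V assms adj_irrefl by (auto simp: n_def)
    have pq: "p i \<noteq> q j" if "0 < i" "i \<le> n" "0 < j" "j \<le> n" for i j
    proof
      assume e: "p i = q j"
      have "i = j" using p(5)[of 0 i] q(5)[of 0 j] p q e that by simp
      then have "dst (p i) x = dst (p i) y" "dst (p i) x < n"
        using p(5)[of i n] q(5)[of i n] p q e that by auto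
      then show False using less.hyps[of "p i"] p(4)[of i] that by (auto simp: n_def)
    qed
    have pinj: "inj_on p {..n}"
      by (rule inj_onI) (metis p(4,5) atMost_iff diff_is_0_eq dst_self linorder_le_cases order_antisym)
    have qinj: "inj_on q {..n}"
      by (rule inj_onI) (metis q(4,5) atMost_iff diff_is_0_eq dst_self linorder_le_cases order_antisym)
    \<comment> \<open>Back from \<open>x\<close> along \<open>p\<close> and out to \<open>y\<close>
      along \<open>q\<close>; \<open>p\<close> is taken from index 1 because \<open>q\<close>
      already contributes the common start \<open>v\<close>.\<close>
    let ?xs = "rev (map p [1..<Suc n]) @ map q [0..<Suc n]"
    have q0: "p i \<noteq> q 0" if "0 < i" "i \<le> n" for i
      using that p q pinj by (metis atMost_iff inj_onD less_numeral_extra(3) zero_le)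
    have "walk V E ?xs"
      unfolding walk_def successively_append_iff successively_rev
    proof (intro conjI)
      show "set ?xs \<subseteq> V" using p(4) q(4) by auto
      show "successively (\<lambda>x y. E y x) (map p [1..<Suc n])"
        using p(3) adj_sym by (intro successively_map_upt) auto
      show "successively E (map q [0..<Suc n])"
        using q(3) by (intro successively_map_upt) auto
      have "E (p 1) v" using p(1,3) n0 adj_sym by (metis One_nat_def gr0I)
      then show "rev (map p [1..<Suc n]) = [] \<or> map q [0..<Suc n] = [] \<or>
          E (last (rev (map p [1..<Suc n]))) (hd (map q [0..<Suc n]))"
        using n0 q(1) by (simp add: last_rev hd_map upt_conv_Cons del: upt_Suc)
    qed simp
    moreover have "distinct ?xs"
    proof -
      have "set (map p [1..<Suc n]) \<inter> set (map q [0..<Suc n]) = {}"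
        using pq q0 by (auto simp del: upt_Suc) (metis bot_nat_0.not_eq_extremum less_Suc_eq_le less_eq_Suc_le)
      moreover have "distinct (map p [1..<Suc n])" "distinct (map q [0..<Suc n])"
        unfolding distinct_map
        using inj_on_subset[OF pinj] inj_on_subset[OF qinj] by (simp_all add: subset_iff del: upt_Suc)
      ultimately show ?thesis by (simp del: upt_Suc)
    qed
    moreover have "3 \<le> length ?xs" using n0 by simp
    moreover have "E (last ?xs) (hd ?xs)"
    proof -
      have "hd ?xs = x" using p(2) n0 by (simp add: hd_append hd_rev last_map)
      moreover have "last ?xs = y" using q(2) by (simp add: last_map)
      ultimately show ?thesis using adj_sym[OF assms(1)] by simp
    qed
    ultimately show False by (rule cycle_contradiction)
  qed
qed

lemma dst_adj_cases:
  assumes "E x y" "v \<in> V"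
  obtains "dst v x = dst v y + 1" | "dst v y = dst v x + 1"
proof -
  have V: "x \<in> V" "y \<in> V" using adj_in_verts assms(1) by auto
  have "dst v x \<le> dst v y + 1" "dst v y \<le> dst v x + 1"
    using dst_triangle[of v y x] dst_triangle[of v x y] dst_adj[OF assms(1)]
      dst_adj[OF adj_sym[OF assms(1)]] V assms(2) by auto
  with dst_adj_neq[OF assms] that show thesis by linarith
qed

lemma in_half_iff: "\<lbrakk>E x y; v \<in> V\<rbrakk> \<Longrightarrow> v \<in> half V E x y \<longleftrightarrow> dst v x = dst v y + 1"
  by (cases rule: dst_adj_cases[of x y v]) (auto simp: half_def)

lemma half_compl: 
  assumes "E x y" shows "V - half V E x y = half V E y x"
proof -
  have "\<not> dst v y < dst v x \<longleftrightarrow> dst v x < dst v y" if "v \<in> V" for v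
    using dst_adj_neq[OF assms that] by linarith
  then show ?thesis by (auto simp: half_def)
qed

lemma half_edge_end:
  assumes "E x y"
  shows "y \<in> half V E x y" "x \<notin> half V E x y"
  using assms dst_adj[OF adj_sym[OF assms]] adj_in_verts[OF assms] by (auto simp: half_def)

text \<open>A second edge between the two sides, together with geodesics from \<open>u\<close> to
  \<open>y\<close> and from \<open>x\<close> to \<open>w\<close>, each staying on its own side,
  would form a cycle.\<close>

lemma half_crossing:
  assumes E: "E x y" and uw: "E u w" and u: "u \<in> half V E x y" and w: "w \<notin> half V E x y"
  shows "u = y \<and> w = x"
proof (rule ccontr)
  assume nt: "\<not> (u = y \<and> w = x)"
  have V: "x \<in> V" "y \<in> V" "u \<in> V" "w \<in> V" using adj_in_verts E uw by auto
  have w': "w \<in> half V E y x" using w V half_compl[OF E] by blast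
  define m where "m = dst u y"
  define n where "n = dst x w"
  obtain p where p: "p 0 = u" "p m = y" "\<And>i. i < m \<Longrightarrow> E (p i) (p (Suc i))"
    "\<And>i. i \<le> m \<Longrightarrow> p i \<in> V" "\<And>i j. i \<le> j \<Longrightarrow> j \<le> m \<Longrightarrow> dst (p i) (p j) = j - i"
    using geodesic[OF V(3) V(2)] by (auto simp: m_def)
  obtain q where q: "q 0 = x" "q n = w" "\<And>i. i < n \<Longrightarrow> E (q i) (q (Suc i))"
    "\<And>i. i \<le> n \<Longrightarrow> q i \<in> V" "\<And>i j. i \<le> j \<Longrightarrow> j \<le> n \<Longrightarrow> dst (q i) (q j) = j - i"
    using geodesic[OF V(1) V(4)] by (auto simp: n_def)
  have ph: "dst (p i) y < dst (p i) x" if "i \<le> m" for i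
  proof -
    have "dst u x \<le> dst u (p i) + dst (p i) x" using V p(4)[OF that] by (intro dst_triangle) auto
    moreover have "dst u x = m + 1" using in_half_iff[OF E V(3)] u by (simp add: m_def)
    ultimately show ?thesis using p(5)[of 0 i] p(5)[of i m] that p by simp
  qed
  have qh: "dst (q i) x < dst (q i) y" if "i \<le> n" for i
  proof -
    have "dst w y \<le> dst w (q i) + dst (q i) y" using V q(4)[OF that] by (intro dst_triangle) auto
    moreover have "dst w y = n + 1" 
      using in_half_iff[OF adj_sym[OF E] V(4)] w' dst_commute V by (simp add: n_def)
    moreover have "dst w (q i) = n - i" "dst (q i) x = i"
      using q(5)[of i n] q(5)[of 0 i] q(4)[OF that] that q V dst_commute by auto
    ultimately show ?thesis using that by simp
  qed
  have pinj: "inj_on p {..m}"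
    by (rule inj_onI) (metis p(4,5) atMost_iff diff_is_0_eq dst_self linorder_le_cases order_antisym)
  have qinj: "inj_on q {..n}"
    by (rule inj_onI) (metis q(4,5) atMost_iff diff_is_0_eq dst_self linorder_le_cases order_antisym)
  let ?xs = "map p [0..<Suc m] @ map q [0..<Suc n]"
  have "walk V E ?xs"
    unfolding walk_def successively_append_iff
  proof (intro conjI)
    show "set ?xs \<subseteq> V" using p(4) q(4) by auto
    show "successively E (map p [0..<Suc m])"
      using p(3) by (intro successively_map_upt) auto
    show "successively E (map q [0..<Suc n])"
      using q(3) by (intro successively_map_upt) auto
    show "map p [0..<Suc m] = [] \<or> map q [0..<Suc n] = [] \<or>
        E (last (map p [0..<Suc m])) (hd (map q [0..<Suc n]))"
      using p q adj_sym[OF E] by (simp add: last_map hd_map del: upt_Suc)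
  qed simp
  moreover have "distinct ?xs"
  proof -
    have "p i \<noteq> q j" if "i \<le> m" "j \<le> n" for i j
      using ph[OF that(1)] qh[OF that(2)] by auto
    then have "set (map p [0..<Suc m]) \<inter> set (map q [0..<Suc n]) = {}"
      by (auto simp del: upt_Suc simp: less_Suc_eq_le)
    moreover have "distinct (map p [0..<Suc m])" "distinct (map q [0..<Suc n])"
      unfolding distinct_map
      using inj_on_subset[OF pinj] inj_on_subset[OF qinj] by (simp_all add: subset_iff del: upt_Suc)
    ultimately show ?thesis by (simp del: upt_Suc)
  qed
  moreover have "3 \<le> length ?xs"
  proof -
    \<comment> \<open>If both geodesics were trivial, the second edge would be the first
      one.\<close>
    have "m + n \<noteq> 0" using nt V by (auto simp: m_def n_def)
    then have "1 \<le> m + n" by linarith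
    then show ?thesis by simp
  qed
  moreover have "E (last ?xs) (hd ?xs)"
  proof -
    have "hd ?xs = u" using p(1) by (simp add: hd_append hd_map del: upt_Suc)
    moreover have "last ?xs = w" using q(2) by (simp add: last_map)
    ultimately show ?thesis using adj_sym[OF uw] by simp
  qed
  ultimately show False by (rule cycle_contradiction)
qed

text \<open>By \<open>half_crossing\<close> a geodesic from \<open>u\<close> to \<open>w\<close> can
  leave the half-tree only along the edge; the induction follows it until it does.\<close>

lemma dst_across_edge:
  assumes E: "E x y" and u: "u \<in> half V E x y" and w: "w \<in> V" "w \<notin> half V E x y"
  shows "dst u w = dst u y + 1 + dst x w"
  using u
proof (induction "dst u w" arbitrary: u)
  case 0
  then show ?case using w by (auto simp: half_def)
next
  case (Suc n)
  have V: "x \<in> V" "y \<in> V" "u \<in> V" using adj_in_verts E Suc.prems by (auto simp: half_def)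
  have le: "dst u w \<le> dst u y + 1 + dst x w"
    using dst_triangle[of u y w] dst_triangle[of y x w] dst_adj[OF adj_sym[OF E]] V w by simp
  obtain v where v: "E u v" "v \<in> V" "dst v w = n"
    using dst_Suc_step[of u w n] Suc.hyps(2) V w by auto
  show ?case
  proof (cases "v \<in> half V E x y")
    case True
    have "n = dst v y + 1 + dst x w" using Suc.hyps(1)[OF _ True] v by simp
    moreover have "dst u y \<le> 1 + dst v y"
      using dst_triangle[of u v y] dst_adj[OF v(1)] V v by simp
    ultimately show ?thesis using le Suc.hyps(2) by simp
  next
    case False
    then have "u = y" "v = x" using half_crossing[OF E v(1) Suc.prems] by auto
    then show ?thesis using v Suc.hyps(2) V by simp
  qed
qed

text \<open>\<open>y\<close> acts as the root of the half-tree: every path that leaves it passes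
  through \<open>y\<close>.\<close>

lemma dst_via_root:
  assumes E: "E x y" and u: "u \<in> half V E x y" and w: "w \<in> V" "w \<notin> half V E x y"
  shows "dst u w = dst u y + dst y w"
  using dst_across_edge[OF assms] dst_across_edge[OF E half_edge_end(1)[OF E] w] adj_in_verts[OF E]
  by simp

text \<open>Both edges point away from \<open>x\<close> and start equally far from it, so the
  geodesic from \<open>x\<close> to a common vertex \<open>z\<close> would traverse both at the same
  position.\<close>

lemma half_disjoint_or_eq:
  assumes E: "E a b" "E a' b'" and x: "x \<in> V" "x \<notin> half V E a b" "x \<notin> half V E a' b'"
    and d: "dst x a = dst x a'"
    and z: "z \<in> half V E a b" "z \<in> half V E a' b'"
  shows "a' = a \<and> b' = b"
proof -
  have V: "a \<in> V" "b \<in> V" "a' \<in> V" "b' \<in> V" "z \<in> V"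
    using E adj_in_verts z by (auto simp: half_def)
  have z1: "dst z x = dst z b + 1 + dst a x" using dst_across_edge[OF E(1) z(1) x(1,2)] .
  have z2: "dst z x = dst z b' + 1 + dst a' x" using dst_across_edge[OF E(2) z(2) x(1,3)] .
  have d': "dst a x = dst a' x" using d V x dst_commute by metis
  have b'x: "dst b' x = 1 + dst a' x" 
    using dst_across_edge[OF E(2) half_edge_end(1)[OF E(2)] x(1,3)] V by simp
  have bb: "b' = b"
  proof (cases "b' \<in> half V E a b")
    case True
    then have "dst b' x = dst b' b + 1 + dst a x" using dst_across_edge[OF E(1) _ x(1,2)] by blast
    then have "dst b' b = 0" using b'x d' by simp
    then show ?thesis using V by simp
  next
    case False
    have "dst z b' = dst z b + 1 + dst a b'" using dst_across_edge[OF E(1) z(1) V(4) False] .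
    then show ?thesis using z1 z2 d' by simp
  qed
  have "a' \<notin> half V E a b"
  proof
    assume "a' \<in> half V E a b"
    then have "dst a' x = dst a' b + 1 + dst a x" using dst_across_edge[OF E(1) _ x(1,2)] by blast
    then show False using d' by simp
  qed
  then have "a' = a"
    using half_crossing[OF E(1) adj_sym[OF E(2)]] bb half_edge_end(1)[OF E(1)] by blast
  with bb show ?thesis by simp
qed

text \<open>An edge outside a half-tree cannot separate it; the side on which \<open>b\<close> lies
  decides which inclusion holds.\<close>

lemma half_subset_or_subset_compl:
  assumes E: "E a b" "E x y" and xy: "x \<notin> half V E a b" "y \<notin> half V E a b"
  shows "half V E a b \<subseteq> half V E x y \<or> half V E a b \<subseteq> half V E y x"
proof -
  have *: "half V E a b \<subseteq> half V E x y"
    if E': "E x y" and xy: "x \<notin> half V E a b" "y \<notin> half V E a b" and b: "b \<in> half V E x y" for x y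
  proof
    fix z assume z: "z \<in> half V E a b"
    have V: "x \<in> V" "y \<in> V" "b \<in> V" "z \<in> V" using adj_in_verts E E' z by (auto simp: half_def)
    show "z \<in> half V E x y"
    proof (rule ccontr)
      assume "z \<notin> half V E x y"
      then have "dst b z = dst b y + 1 + dst x z" using dst_across_edge[OF E' b V(4)] by blast
      moreover have "dst z x = dst z b + 1 + dst a x" using dst_across_edge[OF E(1) z V(1) xy(1)] .
      ultimately show False using V dst_commute by simp
    qed
  qed
  have "b \<in> half V E x y \<or> b \<in> half V E y x"
    using half_compl[OF E(2)] adj_in_verts[OF E(1)] by blast
  then show ?thesis using *[OF E(2)] *[OF adj_sym[OF E(2)]] xy by blast
qed

text \<open>Geodesic triangles are tripods. The first edge from \<open>v\<close> towards
  \<open>c\<close> separates \<open>a\<close> from \<open>c\<close>, and the side of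
  \<open>b\<close> decides the case.\<close>

lemma geodesic_subset_union:
  assumes V: "a \<in> V" "b \<in> V" "c \<in> V" "v \<in> V" and v: "dst a v + dst v c = dst a c"
  shows "dst a v + dst v b = dst a b \<or> dst b v + dst v c = dst b c"
proof (cases "dst v c")
  case 0
  then have "v = c" using V by simp
  then show ?thesis using V by simp
next
  case (Suc n)
  then obtain w where w: "E v w" "w \<in> V" "dst w c = n" using dst_Suc_step V by blast
  have c: "c \<in> half V E v w"
    using w Suc V dst_commute by (simp add: half_def)
  have a: "a \<notin> half V E v w"
  proof
    assume "a \<in> half V E v w"
    then have "dst a v = dst a w + 1" using in_half_iff[OF w(1) V(1)] by simp
    then show False using dst_triangle[of a w c] w V v Suc by simp
  qed
  show ?thesis
  proof (cases "b \<in> half V E v w")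
    case True
    show ?thesis 
      using dst_across_edge[OF w(1) True V(1) a] in_half_iff[OF w(1) V(2)] True V dst_commute by auto
  next
    case False
    show ?thesis 
      using dst_across_edge[OF w(1) c V(2) False] in_half_iff[OF w(1) V(3)] c V dst_commute by auto
  qed
qed

end

context locally_finite_tree
begin

lemma finite_ball:
  assumes "x \<in> V"
  shows "finite {v \<in> V. dst v x \<le> n}"
proof (induction n)
  case 0
  have "{v \<in> V. dst v x \<le> 0} \<subseteq> {x}" using assms by auto
  then show ?case using finite_subset by blast
next
  case (Suc n)
  have "{v \<in> V. dst v x \<le> Suc n} \<subseteq>
      {v \<in> V. dst v x \<le> n} \<union> (\<Union>u\<in>{v \<in> V. dst v x \<le> n}. {w. E u w})"
  proof
    fix v assume v: "v \<in> {v \<in> V. dst v x \<le> Suc n}"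
    show "v \<in> {v \<in> V. dst v x \<le> n} \<union> (\<Union>u\<in>{v \<in> V. dst v x \<le> n}. {w. E u w})"
    proof (cases "dst v x = Suc n")
      case True
      then obtain z where "E v z" "z \<in> V" "dst z x = n" using dst_Suc_step v assms by blast
      then show ?thesis using adj_sym by auto
    qed (use v in auto)
  qed
  moreover have "finite ({v \<in> V. dst v x \<le> n} \<union> (\<Union>u\<in>{v \<in> V. dst v x \<le> n}. {w. E u w}))"
    using Suc finite_neighbours by auto
  ultimately show ?case using finite_subset by blast
qed

end

section \<open>Groups of tree automorphisms\<close>

locale tree_group = locally_finite_tree V E for V :: "'v set" and E +
  fixes H :: "('v \<Rightarrow> 'v) set"
  assumes subgroup_H: "subgroup H (aut_group V E)"
begin

abbreviation GH :: "('v \<Rightarrow> 'v) monoid" where "GH \<equiv> (aut_group V E)\<lparr>carrier := H\<rparr>"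
abbreviation TH :: "('v \<Rightarrow> 'v) topology" where "TH \<equiv> subtopology (permutation_topology V E) H"
text \<open>The operations of the subgroup get constants of their own, with simplification rules
  that evaluate them at vertices.\<close>

definition mul :: "('v \<Rightarrow> 'v) \<Rightarrow> ('v \<Rightarrow> 'v) \<Rightarrow> 'v \<Rightarrow> 'v" (infixl "\<odot>" 70)
  where "g \<odot> h = g \<otimes>\<^bsub>GH\<^esub> h"
definition idn :: "'v \<Rightarrow> 'v" where "idn = \<one>\<^bsub>GH\<^esub>"
definition iv :: "('v \<Rightarrow> 'v) \<Rightarrow> 'v \<Rightarrow> 'v" where "iv g = inv\<^bsub>GH\<^esub> g"
definition pw :: "('v \<Rightarrow> 'v) \<Rightarrow> int \<Rightarrow> 'v \<Rightarrow> 'v" where "pw g k = g [^]\<^bsub>GH\<^esub> k"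
abbreviation Fx :: "'v set \<Rightarrow> ('v \<Rightarrow> 'v) set" where "Fx \<equiv> pointwise_stabiliser H"
abbreviation hf :: "'v \<Rightarrow> 'v \<Rightarrow> 'v set" where "hf \<equiv> half V E"

lemma group_GH: "group GH"
  by (rule subgroup.subgroup_is_group[OF subgroup_H group_aut_group])

sublocale GH: group GH
  by (rule group_GH)

lemma H_in_aut: "g \<in> H \<Longrightarrow> g \<in> carrier (aut_group V E)"
  by (rule subgroup.mem_carrier[OF subgroup_H])

lemma mul_closed [simp]: "\<lbrakk>g \<in> H; h \<in> H\<rbrakk> \<Longrightarrow> g \<odot> h \<in> H"
  using GH.m_closed by (simp add: mul_def)

lemma idn_in_H [simp]: "idn \<in> H"
  using GH.one_closed by (simp add: idn_def)

lemma iv_closed [simp]: "g \<in> H \<Longrightarrow> iv g \<in> H"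
  using GH.inv_closed by (simp add: iv_def)

lemma pw_closed [simp]: "g \<in> H \<Longrightarrow> pw g k \<in> H"
  using GH.int_pow_closed by (simp add: pw_def)

lemma H_bij: "g \<in> H \<Longrightarrow> bij_betw g V V"
  using H_in_aut by (auto simp: carrier_aut_group Bij_def)

lemma H_closed [simp]: "\<lbrakk>g \<in> H; v \<in> V\<rbrakk> \<Longrightarrow> g v \<in> V"
  using H_bij bij_betwE by blast

lemma H_inj [simp]: "\<lbrakk>g \<in> H; v \<in> V; w \<in> V\<rbrakk> \<Longrightarrow> g v = g w \<longleftrightarrow> v = w"
  using H_bij[of g] by (auto simp: bij_betw_def inj_on_def)

lemma H_adj: "\<lbrakk>g \<in> H; E x y\<rbrakk> \<Longrightarrow> E (g x) (g y)"
  using H_in_aut adj_in_verts by (fastforce simp: carrier_aut_group)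

lemma H_ext: "\<lbrakk>g \<in> H; h \<in> H; \<And>v. v \<in> V \<Longrightarrow> g v = h v\<rbrakk> \<Longrightarrow> g = h"
  using H_in_aut by (auto simp: carrier_aut_group Bij_def intro: extensionalityI)

lemma H_undefined: "\<lbrakk>g \<in> H; v \<notin> V\<rbrakk> \<Longrightarrow> g v = undefined"
  using H_in_aut by (auto simp: carrier_aut_group Bij_def extensional_def)

lemma mul_apply [simp]: "\<lbrakk>g \<in> H; h \<in> H; v \<in> V\<rbrakk> \<Longrightarrow> (g \<odot> h) v = g (h v)"
  using mult_aut_group[OF H_in_aut H_in_aut] by (simp add: mul_def compose_eq)

lemma idn_apply [simp]: "v \<in> V \<Longrightarrow> idn v = v"
  by (simp add: idn_def aut_group_def BijGroup_def)

lemma iv_mul: "g \<in> H \<Longrightarrow> iv g \<odot> g = idn" "g \<in> H \<Longrightarrow> g \<odot> iv g = idn"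
  using GH.l_inv[of g] GH.r_inv[of g] by (simp_all add: mul_def iv_def idn_def)

lemma iv_apply [simp]:
  assumes "g \<in> H" "v \<in> V"
  shows "iv g (g v) = v" "g (iv g v) = v"
  using fun_cong[OF iv_mul(1)[OF assms(1)], of v] fun_cong[OF iv_mul(2)[OF assms(1)], of v] assms
  by simp_all

lemma pw_add: "\<lbrakk>g \<in> H; v \<in> V\<rbrakk> \<Longrightarrow> pw g (i + j) v = pw g i (pw g j v)"
proof -
  assume g: "g \<in> H" "v \<in> V"
  have "pw g (i + j) = pw g i \<odot> pw g j"
    using GH.int_pow_mult[of g i j] g by (simp add: pw_def mul_def)
  then show ?thesis using g by simp
qed

lemma pw_0 [simp]: "v \<in> V \<Longrightarrow> pw g 0 v = v"
  using idn_apply[of v] by (simp add: pw_def idn_def)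

lemma pw_1 [simp]: "g \<in> H \<Longrightarrow> pw g 1 = g"
  using GH.int_pow_1[of g] by (simp add: pw_def)

lemma pw_uminus: "g \<in> H \<Longrightarrow> pw (iv g) k = pw g (- k)"
  using GH.int_pow_inv[of g k] GH.int_pow_neg[of g k] by (simp add: pw_def iv_def)

lemma pw_cancel [simp]:
  assumes "g \<in> H" "v \<in> V"
  shows "pw g (- k) (pw g k v) = v" "pw g k (pw g (- k) v) = v"
  using pw_add[OF assms, of "- k" k] pw_add[OF assms, of k "- k"] assms by simp_all

lemma H_dst [simp]:
  assumes "g \<in> H" "x \<in> V" "y \<in> V"
  shows "dst (g x) (g y) = dst x y"
proof -
  have rel: "(E ^^ n) (h x) (h y)" if "h \<in> H" "(E ^^ n) x y" for h n x y
    using that(2)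
  proof (induction n arbitrary: y)
    case (Suc n)
    then obtain z where "(E ^^ n) x z" "E z y" by (auto elim: relpowp_Suc_E)
    then show ?case using Suc.IH H_adj[OF that(1)] by (blast intro: relpowp_Suc_I)
  qed simp
  have le: "dst (h x) (h y) \<le> dst x y" if "h \<in> H" "x \<in> V" "y \<in> V" for h x y
    using dst_le rel[OF that(1) relpowp_dst[OF that(2,3)]] that by simp
  show ?thesis
    using le[of g x y] le[of "iv g" "g x" "g y"] assms by simp
qed

lemma H_half_mem [simp]:
  "\<lbrakk>g \<in> H; x \<in> V; y \<in> V; v \<in> V\<rbrakk> \<Longrightarrow> g v \<in> hf (g x) (g y) \<longleftrightarrow> v \<in> hf x y"
  by (simp add: half_def)

lemma half_mem_iff:
  "\<lbrakk>g \<in> H; x \<in> V; y \<in> V; v \<in> V\<rbrakk> \<Longrightarrow> v \<in> hf (g x) (g y) \<longleftrightarrow> iv g v \<in> hf x y"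
  using H_half_mem[of g x y "iv g v"] by simp

lemma image_half:
  assumes "g \<in> H" "x \<in> V" "y \<in> V"
  shows "g ` hf x y = hf (g x) (g y)"
proof
  show "g ` hf x y \<subseteq> hf (g x) (g y)" using assms half_subset by fastforce
  show "hf (g x) (g y) \<subseteq> g ` hf x y"
  proof
    fix v assume v: "v \<in> hf (g x) (g y)"
    then have "v \<in> V" using half_subset by blast
    then show "v \<in> g ` hf x y" 
      using v half_mem_iff[OF assms] assms by (intro image_eqI[of _ _ "iv g v"]) auto
  qed
qed

lemma Fx_iff: "u \<in> Fx A \<longleftrightarrow> u \<in> H \<and> (\<forall>x\<in>A. u x = x)"
  by (simp add: pointwise_stabiliser_def)

lemma iv_fix: "\<lbrakk>u \<in> H; v \<in> V; u v = v\<rbrakk> \<Longrightarrow> iv u v = v"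
  by (metis iv_apply(1))

lemma openin_TH:
  "openin TH S \<longleftrightarrow> S \<subseteq> H \<and>
     (\<forall>g\<in>S. \<exists>A. finite A \<and> A \<subseteq> V \<and> {h \<in> H. \<forall>x\<in>A. h x = g x} \<subseteq> S)"
proof
  assume "openin TH S"
  then obtain W where W: "openin (permutation_topology V E) W" "S = W \<inter> H"
    by (auto simp: openin_subtopology)
  show "S \<subseteq> H \<and> (\<forall>g\<in>S. \<exists>A. finite A \<and> A \<subseteq> V \<and> {h \<in> H. \<forall>x\<in>A. h x = g x} \<subseteq> S)"
  proof (intro conjI ballI)
    fix g assume "g \<in> S"
    then obtain A where "finite A" "A \<subseteq> V" "{h \<in> carrier (aut_group V E). \<forall>x\<in>A. h x = g x} \<subseteq> W"
      using W unfolding openin_permutation_topology by blast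
    then show "\<exists>A. finite A \<and> A \<subseteq> V \<and> {h \<in> H. \<forall>x\<in>A. h x = g x} \<subseteq> S"
      using W(2) H_in_aut by (intro exI[of _ A]) blast
  qed (use W in blast)
next
  assume S: "S \<subseteq> H \<and> (\<forall>g\<in>S. \<exists>A. finite A \<and> A \<subseteq> V \<and> {h \<in> H. \<forall>x\<in>A. h x = g x} \<subseteq> S)"
  \<comment> \<open>The union of the basic open sets of the full automorphism group that are centred
    in \<open>S\<close> and whose trace on \<open>H\<close> lies in \<open>S\<close>.\<close>
  define W where "W = {h \<in> carrier (aut_group V E).
    \<exists>g\<in>S. \<exists>A. finite A \<and> A \<subseteq> V \<and> {h \<in> H. \<forall>x\<in>A. h x = g x} \<subseteq> S \<and> (\<forall>x\<in>A. h x = g x)}"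
  have "openin (permutation_topology V E) W"
    unfolding openin_permutation_topology
  proof (intro conjI ballI)
    fix h assume "h \<in> W"
    then obtain g A where gA: "g \<in> S" "finite A" "A \<subseteq> V" "{h \<in> H. \<forall>x\<in>A. h x = g x} \<subseteq> S" "\<forall>x\<in>A. h x = g x"
      by (auto simp: W_def)
    have "{k \<in> carrier (aut_group V E). \<forall>x\<in>A. k x = h x} \<subseteq> W"
    proof
      fix k assume "k \<in> {k \<in> carrier (aut_group V E). \<forall>x\<in>A. k x = h x}"
      then show "k \<in> W" unfolding W_def using gA by force
    qed
    with gA show "\<exists>A. finite A \<and> A \<subseteq> V \<and> {k \<in> carrier (aut_group V E). \<forall>x\<in>A. k x = h x} \<subseteq> W"
      by blast
  qed (auto simp: W_def)
  moreover have "S = W \<inter> H"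
  proof
    show "S \<subseteq> W \<inter> H"
    proof
      fix g assume g: "g \<in> S"
      then obtain A where "finite A" "A \<subseteq> V" "{h \<in> H. \<forall>x\<in>A. h x = g x} \<subseteq> S" using S by blast
      then show "g \<in> W \<inter> H" using g S H_in_aut by (auto simp: W_def)
    qed
    show "W \<inter> H \<subseteq> S" by (auto simp: W_def)
  qed
  ultimately show "openin TH S" by (auto simp: openin_subtopology)
qed

lemma topspace_TH [simp]: "topspace TH = H"
  using H_in_aut by auto

lemma openin_agree:
  assumes "finite A" "A \<subseteq> V"
  shows "openin TH {h \<in> H. \<forall>x\<in>A. h x = f x}"
  unfolding openin_TH using assms by auto

lemma closedin_Fx:
  assumes "A \<subseteq> V"
  shows "closedin TH (Fx A)"
  unfolding closedin_def
proof (intro conjI)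
  show "Fx A \<subseteq> topspace TH" unfolding topspace_TH by (auto simp: Fx_iff)
  show "openin TH (topspace TH - Fx A)"
    unfolding openin_TH
  proof (intro conjI ballI)
    fix g assume "g \<in> topspace TH - Fx A"
    then obtain a where "a \<in> A" "g a \<noteq> a" by (auto simp: Fx_iff)
    then show "\<exists>B. finite B \<and> B \<subseteq> V \<and> {h \<in> H. \<forall>x\<in>B. h x = g x} \<subseteq> topspace TH - Fx A"
      unfolding topspace_TH using assms by (intro exI[of _ "{a}"]) (auto simp: Fx_iff)
  qed auto
qed

lemma openin_Fx:
  assumes "finite A" "A \<subseteq> V"
  shows "openin TH (Fx A)"
  using openin_agree[OF assms, of "\<lambda>x. x"] by (simp add: pointwise_stabiliser_def)

lemma subgroup_Fx:
  assumes "A \<subseteq> V"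
  shows "subgroup (Fx A) GH"
proof (rule GH.subgroupI)
  have "idn \<in> Fx A" using assms by (auto simp: Fx_iff)
  then show "Fx A \<noteq> {}" by blast
  show "inv\<^bsub>GH\<^esub> a \<in> Fx A" if "a \<in> Fx A" for a
    using that assms iv_fix unfolding iv_def[symmetric] by (auto simp: Fx_iff)
  show "a \<otimes>\<^bsub>GH\<^esub> b \<in> Fx A" if "a \<in> Fx A" "b \<in> Fx A" for a b
  proof -
    have "a \<in> H" "b \<in> H" using that by (auto simp: Fx_iff)
    moreover have "a (b x) = x" if "x \<in> A" for x using \<open>a \<in> Fx A\<close> \<open>b \<in> Fx A\<close> that by (simp add: Fx_iff)
    ultimately show ?thesis using assms unfolding mul_def[symmetric] by (auto simp: Fx_iff subset_iff)
  qed
qed (simp add: pointwise_stabiliser_def)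

end

section \<open>Consequences of non-discreteness, simplicity, local compactness and
  independence\<close>

locale tits_tree_group = tree_group V E H for V :: "'v set" and E H +
  assumes class_S: "class_S GH TH"
    and tits: "tits_independence V E H"
begin

text \<open>If the fixator of a finite set were trivial, its cosets would be open points and the
  topology discrete.\<close>

lemma nondiscrete:
  assumes A: "finite A" "A \<subseteq> V"
  shows "\<exists>u\<in>Fx A. \<exists>v\<in>V. u v \<noteq> v"
proof (rule ccontr)
  assume no: "\<not> ?thesis"
  have triv: "u v = v" if "u \<in> Fx A" "v \<in> V" for u v using no that by blast
  have "openin TH S \<longleftrightarrow> S \<subseteq> H" for S
  proof
    assume S: "S \<subseteq> H"
    have "{h \<in> H. \<forall>x\<in>A. h x = g x} \<subseteq> {g}" if g: "g \<in> H" for g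
    proof
      fix h assume h: "h \<in> {h \<in> H. \<forall>x\<in>A. h x = g x}"
      then have "iv g \<odot> h \<in> Fx A" using g A by (auto simp: Fx_iff subset_iff)
      then have "iv g (h v) = v" if "v \<in> V" for v using triv[OF _ that] h g that by fastforce
      then have "h v = g v" if "v \<in> V" for v using that h g 
        by (metis (no_types, lifting) H_closed iv_apply(2) mem_Collect_eq)
      then show "h \<in> {g}" using H_ext h g by blast
    qed
    then show "openin TH S" unfolding openin_TH using S A by blast
  qed (simp add: openin_TH)
  then have "TH = discrete_topology H" by (simp add: topology_eq openin_discrete_topology)
  then show False using class_S by (simp add: class_S_def)
qed

text \<open>The invariance assumption makes \<open>Fx A\<close> normal. It is closed, and
  non-trivial by \<open>nondiscrete\<close>, so topological simplicity applies.\<close>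

lemma Fx_normal_imp_all:
  assumes A: "finite A" "A \<subseteq> V"
    and inv: "\<And>g u a. \<lbrakk>g \<in> H; u \<in> Fx A; a \<in> A\<rbrakk> \<Longrightarrow> u (g a) = g a"
  shows "Fx A = H"
proof -
  have "Fx A \<lhd> GH"
    unfolding GH.normal_inv_iff
  proof (intro conjI ballI)
    fix g u assume g: "g \<in> carrier GH" and u: "u \<in> Fx A"
    have uH: "u \<in> H" using u by (simp add: Fx_iff)
    have "(g \<odot> u \<odot> iv g) a = a" if "a \<in> A" for a
    proof -
      have "u (iv g a) = iv g a" using inv[of "iv g"] g u that by simp
      then show ?thesis using g uH that A by (auto simp: subset_iff)
    qed
    then show "g \<otimes>\<^bsub>GH\<^esub> u \<otimes>\<^bsub>GH\<^esub> inv\<^bsub>GH\<^esub> g \<in> Fx A"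
      using g uH unfolding mul_def[symmetric] iv_def[symmetric] by (simp add: Fx_iff)
  qed (use subgroup_Fx A in auto)
  moreover have "closedin TH (Fx A)" using closedin_Fx A by blast
  ultimately have "Fx A = {idn} \<or> Fx A = H"
    using class_S by (simp add: class_S_def topologically_simple_def idn_def)
  moreover have "Fx A \<noteq> {idn}"
    using nondiscrete[OF A] idn_apply by auto
  ultimately show ?thesis by blast
qed

lemma nontrivial:
  obtains g v where "g \<in> H" "v \<in> V" "g v \<noteq> v"
  using nondiscrete[of "{}"] by (auto simp: Fx_iff)

text \<open>Local compactness at the identity: a compact neighbourhood of \<open>idn\<close>
  contains some \<open>Fx F\<close>, which is closed.\<close>

lemma compact_stabiliser:
  obtains F where "finite F" "F \<subseteq> V" "compactin TH (Fx F)"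
proof -
  have "\<exists>U K. openin TH U \<and> compactin TH K \<and> idn \<in> U \<and> U \<subseteq> K"
    using class_S idn_in_H unfolding class_S_def locally_compact_space_def topspace_TH by blast
  then obtain U K where U: "openin TH U" "compactin TH K" "idn \<in> U" "U \<subseteq> K" by blast
  then obtain F where F: "finite F" "F \<subseteq> V" "{h \<in> H. \<forall>x\<in>F. h x = idn x} \<subseteq> U"
    unfolding openin_TH by blast
  have "h \<in> U" if "h \<in> Fx F" for h
    using that F idn_apply by (intro subsetD[OF F(3)]) (auto simp: Fx_iff subset_iff)
  then have "Fx F \<subseteq> K" using U by blast
  then have "compactin TH (Fx F)"
    using closed_compactin[OF U(2)] closedin_Fx[OF F(2)] by blast
  then show thesis using that F by blast
qed

lemma compact_Fx_mono:
  assumes "compactin TH (Fx F)" "F \<subseteq> F'" "F' \<subseteq> V"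
  shows "compactin TH (Fx F')"
proof (rule closed_compactin[OF assms(1)])
  show "Fx F' \<subseteq> Fx F" using assms(2) unfolding pointwise_stabiliser_def by blast
qed (rule closedin_Fx[OF assms(3)])

lemma chain_edge:
  assumes "E x y"
  shows "chain_in V E {x, y}"
proof -
  have "x \<noteq> y" "x \<in> V" "y \<in> V" using assms adj_irrefl adj_in_verts by auto
  then show ?thesis
    unfolding chain_in_def using assms
    by (intro exI[of _ "{0, 1}"] exI[of _ "\<lambda>i. if i = 0 then x else y"])
      (auto simp: inj_on_def)
qed

lemma chain_fibre_edge:
  assumes E: "E x y"
  shows "chain_fibre V E {x, y} y = hf x y"
proof -
  have "chain_proj V E {x, y} v = (if v \<in> hf x y then y else x)" if "v \<in> V" for v
    unfolding chain_proj_def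
    using dst_adj_neq[OF E that] that
    by (intro the_equality) (auto simp: is_arg_min_def half_def)
  moreover have "x \<noteq> y" using E adj_irrefl by auto
  ultimately show ?thesis unfolding chain_fibre_def half_def by (auto split: if_splits)
qed

text \<open>Surjectivity in the independence property for the chain of one edge: the pair consisting
  of \<open>u\<close> on one fibre and the identity on the other is attained.\<close>

lemma tits_edge:
  assumes E: "E x y" and u: "u \<in> Fx {x, y}"
  obtains w where "w \<in> Fx {x, y}" "\<And>v. v \<in> hf x y \<Longrightarrow> w v = u v" "\<And>v. v \<in> hf y x \<Longrightarrow> w v = v"
proof -
  let ?C = "{x, y}"
  let ?F = "Fx ?C"
  let ?\<Phi> = "\<lambda>g. \<lambda>c\<in>?C. restrict g (chain_fibre V E ?C c)"
  let ?P = "product_group ?C (\<lambda>c. restricted_group ?F (chain_fibre V E ?C c))"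
  have xy: "x \<noteq> y" using E adj_irrefl by auto
  have fx: "chain_fibre V E ?C x = hf y x" 
    using chain_fibre_edge[OF adj_sym[OF E]] by (simp add: insert_commute)
  have fy: "chain_fibre V E ?C y = hf x y" using chain_fibre_edge[OF E] .
  have one: "idn \<in> ?F" using idn_apply adj_in_verts[OF E] idn_in_H by (simp add: Fx_iff)
  have iso: "?\<Phi> \<in> iso ((aut_group V E)\<lparr>carrier := ?F\<rparr>) ?P"
    using tits chain_edge[OF E] unfolding tits_independence_def Let_def by blast
  define t where "t = (\<lambda>c\<in>?C. restrict (if c = y then u else idn) (chain_fibre V E ?C c))"
  have "t \<in> carrier ?P"
    using u one by (auto simp: t_def product_group_def restricted_group_def)
  moreover have "?\<Phi> ` ?F = carrier ?P"
    using iso by (simp add: iso_def bij_betw_def)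
  ultimately obtain w where w: "w \<in> ?F" "?\<Phi> w = t" by (metis (no_types, lifting) imageE)
  have "restrict w (hf x y) = restrict u (hf x y)"
    using fun_cong[OF w(2), of y] by (simp add: t_def fy)
  then have 1: "w v = u v" if "v \<in> hf x y" for v using that by (metis restrict_apply')
  have "restrict w (hf y x) = restrict idn (hf y x)"
    using fun_cong[OF w(2), of x] xy by (simp add: t_def fx)
  then have "w v = v" if "v \<in> hf y x" for v 
    using that idn_apply half_subset by (metis restrict_apply' subsetD)
  with 1 show thesis using that w by blast
qed

end

section \<open>Local isomorphisms without extension\<close>

context tits_tree_group
begin

definition fat :: "'v set \<Rightarrow> bool" where
  "fat c \<longleftrightarrow> (\<forall>F. finite F \<and> F \<subseteq> V \<longrightarrow> (\<exists>u\<in>Fx (F \<union> (V - c)). \<exists>v\<in>V. u v \<noteq> v))"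

text \<open>The swap \<open>s\<close> moves \<open>c\<close> to \<open>\<gamma> c\<close> and leaves
  \<open>\<alpha> c\<close> in place. An extension applied to \<open>g\<close> would yield a tree
  automorphism sending points of \<open>c\<close> and \<open>\<alpha> c\<close> to points of
  \<open>g \<gamma> c\<close> and \<open>g \<alpha> c\<close>, which are too far apart by
  \<open>dist\<close>.\<close>

lemma not_rigid_of_disjoint_translates:
  fixes p q :: 'v
  defines "c \<equiv> hf p q"
  assumes E: "E p q" and fat: "fat c"
    and H: "\<gamma> \<in> H" "\<alpha> \<in> H" "g \<in> H"
    and disj: "c \<inter> \<gamma> ` c = {}" "c \<inter> \<alpha> ` c = {}" "\<gamma> ` c \<inter> \<alpha> ` c = {}"
      "(g \<odot> \<gamma>) ` c \<inter> (c \<union> \<gamma> ` c) = {}" "(g \<odot> \<alpha>) ` c \<inter> (c \<union> \<gamma> ` c) = {}"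
    and dist: "dst q (\<alpha> q) < dst (\<gamma> q) (\<alpha> q)"
  shows "\<not> rigid GH TH"
proof
  assume rigid: "rigid GH TH"

  \<comment> \<open>The swap of two disjoint half-trees\<close>
  have pq: "p \<in> V" "q \<in> V" using E adj_in_verts by auto
  have cV: "c \<subseteq> V" unfolding c_def by (rule half_subset)
  define s where "s v = (if v \<in> c then \<gamma> v else if iv \<gamma> v \<in> c then iv \<gamma> v else v)" for v
  have \<gamma>c: "v \<notin> c" if "iv \<gamma> v \<in> c" "v \<in> V" for v
    using disj(1) that H by (metis disjoint_iff imageI iv_apply(2))
  have sc: "s v = \<gamma> v" if "v \<in> c" for v using that by (simp add: s_def)
  have s\<gamma>: "s v = iv \<gamma> v" if "iv \<gamma> v \<in> c" "v \<in> V" for v using that \<gamma>c by (simp add: s_def)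
  have sid: "s v = v" if "v \<notin> c" "iv \<gamma> v \<notin> c" for v using that by (simp add: s_def)
  have sV: "s v \<in> V" if "v \<in> V" for v using that H by (simp add: s_def)
  have ss: "s (s v) = v" if "v \<in> V" for v
    using that sc s\<gamma> sid H cV by (metis H_closed iv_apply)
  have s_inj: "s v = s w \<longleftrightarrow> v = w" if "v \<in> V" "w \<in> V" for v w using ss that by metis

  \<comment> \<open>A compact open subgroup preserved by conjugation with the swap\<close>
  obtain F\<^sub>0 where F\<^sub>0: "finite F\<^sub>0" "F\<^sub>0 \<subseteq> V" "compactin TH (Fx F\<^sub>0)" using compact_stabiliser by blast
  \<comment> \<open>\<open>F\<^sub>0\<close> gives compactness, the four endpoints make elements of
    \<open>U\<close> preserve \<open>c\<close> and \<open>\<gamma> c\<close>, and closing under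
    \<open>s\<close> makes conjugation by \<open>s\<close> preserve \<open>U\<close>.\<close>
  define F\<^sub>1 where "F\<^sub>1 = F\<^sub>0 \<union> {p, q, \<gamma> p, \<gamma> q}"
  define F where "F = F\<^sub>1 \<union> s ` F\<^sub>1"
  define U where "U = Fx F"
  have F\<^sub>1V: "F\<^sub>1 \<subseteq> V" using F\<^sub>0 pq H by (auto simp: F\<^sub>1_def)
  have F: "finite F" "F \<subseteq> V" using F\<^sub>0 F\<^sub>1V sV by (auto simp: F_def F\<^sub>1_def)
  have sF: "s a \<in> F" if "a \<in> F" for a using that ss F\<^sub>1V by (auto simp: F_def)
  have UH: "u \<in> H" if "u \<in> U" for u using that by (simp add: U_def Fx_iff)
  have UF: "u a = a" if "u \<in> U" "a \<in> F" for u a using that by (simp add: U_def Fx_iff)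
  have pqF: "p \<in> F" "q \<in> F" "\<gamma> p \<in> F" "\<gamma> q \<in> F" by (auto simp: F_def F\<^sub>1_def)
  have Uc: "u v \<in> c \<longleftrightarrow> v \<in> c" if "u \<in> H" "u p = p" "u q = q" "v \<in> V" for u v
    using H_half_mem[of u p q v] that pq by (simp add: c_def)
  have \<gamma>half: "v \<in> hf (\<gamma> p) (\<gamma> q) \<longleftrightarrow> iv \<gamma> v \<in> c" if "v \<in> V" for v
    using half_mem_iff[OF H(1) pq that] by (simp add: c_def)
  have U\<gamma>: "iv \<gamma> (u v) \<in> c \<longleftrightarrow> iv \<gamma> v \<in> c" 
    if "u \<in> H" "u (\<gamma> p) = \<gamma> p" "u (\<gamma> q) = \<gamma> q" "v \<in> V" for u v
    using H_half_mem[of u "\<gamma> p" "\<gamma> q" v] that pq H \<gamma>half[of v] \<gamma>half[of "u v"] by simp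
  define \<phi> where "\<phi> u = (\<lambda>v\<in>V. s (u (s v)))" for u
  have \<phi>_apply: "\<phi> u v = s (u (s v))" if "v \<in> V" for u v using that by (simp add: \<phi>_def)
  \<comment> \<open>By independence \<open>u\<close> is a product of elements \<open>u1\<close>,
    \<open>u2\<close>, \<open>u3\<close> of \<open>H\<close> acting on \<open>c\<close>, on
    \<open>\<gamma> c\<close> and elsewhere. Conjugation by \<open>s\<close> turns \<open>u1\<close>
    and \<open>u2\<close> into their conjugates by \<gamma> and its inverse and does not change
    \<open>u3\<close>, so the product \<open>w\<close> stays in \<open>H\<close>.\<close>
  have \<phi>H: "\<phi> u \<in> H" if u: "u \<in> U" for u
  proof -
    note uH = UH[OF u]
    have "u \<in> Fx {p, q}" using uH UF[OF u] pqF by (simp add: Fx_iff)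
    then obtain u1 where u1: "u1 \<in> Fx {p, q}" "\<And>v. v \<in> hf p q \<Longrightarrow> u1 v = u v" "\<And>v. v \<in> hf q p \<Longrightarrow> u1 v = v"
      using tits_edge[OF E] by blast
    have "u \<in> Fx {\<gamma> p, \<gamma> q}" using uH UF[OF u] pqF by (simp add: Fx_iff)
    then obtain u2 where u2: "u2 \<in> Fx {\<gamma> p, \<gamma> q}" "\<And>v. v \<in> hf (\<gamma> p) (\<gamma> q) \<Longrightarrow> u2 v = u v"
       "\<And>v. v \<in> hf (\<gamma> q) (\<gamma> p) \<Longrightarrow> u2 v = v"
      using tits_edge[OF H_adj[OF H(1) E]] by blast
    have u1H: "u1 \<in> H" "u1 p = p" "u1 q = q" using u1 by (auto simp: Fx_iff)
    have u2H: "u2 \<in> H" "u2 (\<gamma> p) = \<gamma> p" "u2 (\<gamma> q) = \<gamma> q" using u2 by (auto simp: Fx_iff)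
    have u1c: "u1 v = u v" if "v \<in> c" for v using u1(2) that by (simp add: c_def)
    have u1n: "u1 v = v" if "v \<in> V" "v \<notin> c" for v
      using u1(3) that half_compl[OF E] by (auto simp: c_def)
    have u2c: "u2 v = u v" if "v \<in> V" "iv \<gamma> v \<in> c" for v using u2(2) that \<gamma>half by blast
    have u2n: "u2 v = v" if "v \<in> V" "iv \<gamma> v \<notin> c" for v
      using u2(3) that half_compl[OF H_adj[OF H(1) E]] \<gamma>half by blast
    define u3 where "u3 = u \<odot> iv u1 \<odot> iv u2"
    have u3H: "u3 \<in> H" using uH u1H u2H by (simp add: u3_def)
    have u3_apply: "u3 v = u (iv u1 (iv u2 v))" if "v \<in> V" for v
      using that uH u1H u2H by (simp add: u3_def)
    have u3c: "u3 v = v" if "v \<in> c" for v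
    proof -
      have v: "v \<in> V" "iv \<gamma> v \<notin> c" using that cV \<gamma>c by blast+
      have "iv u2 v = v" using iv_fix[OF u2H(1) v(1)] u2n v by simp
      moreover have "iv u1 v \<in> c" using Uc[OF u1H, of "iv u1 v"] u1H v that by simp
      ultimately show ?thesis using u3_apply[OF v(1)] u1c[of "iv u1 v"] u1H v by simp
    qed
    have u3\<gamma>: "u3 v = v" if "v \<in> V" "iv \<gamma> v \<in> c" for v
    proof -
      define z where "z = iv u2 v"
      have z: "z \<in> V" "u2 z = v" using that u2H by (auto simp: z_def)
      then have zc: "iv \<gamma> z \<in> c" using U\<gamma>[OF u2H z(1)] that by simp
      have "iv u1 z = z" using iv_fix[OF u1H(1) z(1)] u1n[OF z(1)] \<gamma>c[OF zc z(1)] by simp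
      then show ?thesis using u3_apply[OF that(1)] u2c[OF z(1) zc] z(2) by (simp add: z_def[symmetric])
    qed
    have u3n: "u3 v = u v" if "v \<in> V" "v \<notin> c" "iv \<gamma> v \<notin> c" for v
      using u3_apply[OF that(1)] iv_fix[OF u1H(1) that(1)] iv_fix[OF u2H(1) that(1)]
        u1n[OF that(1,2)] u2n[OF that(1,3)] by simp
    define w where "w = u3 \<odot> (\<gamma> \<odot> u1 \<odot> iv \<gamma>) \<odot> (iv \<gamma> \<odot> u2 \<odot> \<gamma>)"
    have wH: "w \<in> H" using u3H u1H u2H H by (simp add: w_def)
    have w_apply: "w v = u3 (\<gamma> (u1 (iv \<gamma> (iv \<gamma> (u2 (\<gamma> v))))))" if "v \<in> V" for v
      using that u3H u1H u2H H by (simp add: w_def)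
    have "w v = s (u (s v))" if v: "v \<in> V" for v
    proof -
      consider "v \<in> c" | "iv \<gamma> v \<in> c" | "v \<notin> c" "iv \<gamma> v \<notin> c" by blast
      then show ?thesis
      proof cases
        case 1
        define z where "z = iv \<gamma> (u (\<gamma> v))"
        have zV: "z \<in> V" using v H uH by (simp add: z_def)
        have zc: "z \<in> c" using U\<gamma>[OF uH, of "\<gamma> v"] UF[OF u] pqF v H 1 by (simp add: z_def)
        have "s (u (s v)) = z"
          unfolding sc[OF 1] z_def using zc v H uH by (intro s\<gamma>) (simp_all add: z_def)
        moreover have "iv \<gamma> (u2 (\<gamma> v)) = z" using u2c[of "\<gamma> v"] 1 v H by (simp add: z_def)
        moreover have "u1 (iv \<gamma> z) = iv \<gamma> z" using u1n[of "iv \<gamma> z"] zc zV \<gamma>c[of z] H by auto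
        ultimately show ?thesis using w_apply[OF v] u3c[OF zc] zV H by simp
      next
        case 2
        define z where "z = \<gamma> (u (iv \<gamma> v))"
        have zV: "z \<in> V" using v H uH by (simp add: z_def)
        have uc: "u (iv \<gamma> v) \<in> c" using Uc[OF uH, of "iv \<gamma> v"] UF[OF u] pqF v H 2 by simp
        then have zc: "iv \<gamma> z \<in> c" using v H uH by (simp add: z_def)
        have "s (u (s v)) = z" unfolding s\<gamma>[OF 2 v] z_def using uc by (rule sc)
        moreover have "u2 (\<gamma> v) = \<gamma> v" using u2n[of "\<gamma> v"] \<gamma>c[OF 2 v] v H by simp
        moreover have "u1 (iv \<gamma> v) = u (iv \<gamma> v)" using u1c[OF 2] .
        ultimately show ?thesis using w_apply[OF v] u3\<gamma>[OF zV zc] v H by (simp add: z_def)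
      next
        case 3
        have "u v \<notin> c" "iv \<gamma> (u v) \<notin> c"
          using Uc[OF uH, of v] U\<gamma>[OF uH, of v] UF[OF u] pqF v 3 by auto
        moreover have "u2 (\<gamma> v) = \<gamma> v" using u2n[of "\<gamma> v"] 3 v H by simp
        moreover have "u1 (iv \<gamma> v) = iv \<gamma> v" using u1n[of "iv \<gamma> v"] 3 v H by simp
        ultimately show ?thesis using w_apply[OF v] u3n[OF v 3] sid 3 v H by simp
      qed
    qed
    then have "\<phi> u = w" using H_undefined[OF wH] by (auto simp: \<phi>_def fun_eq_iff)
    with wH show ?thesis by simp
  qed
  have \<phi>U: "\<phi> u \<in> U" if "u \<in> U" for u
    unfolding U_def Fx_iff
    using \<phi>H[OF that] \<phi>_apply UF[OF that] sF ss F(2) by (auto simp: subset_iff)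
  have \<phi>\<phi>: "\<phi> (\<phi> u) = u" if "u \<in> U" for u
    using that \<phi>U UH by (intro H_ext) (auto simp: \<phi>_apply sV ss)
  have \<phi>mul: "\<phi> (u \<odot> v) = \<phi> u \<odot> \<phi> v" if "u \<in> U" "v \<in> U" for u v
  proof (rule H_ext)
    have "(u \<odot> v) a = a" if "a \<in> F" for a
      using UF[OF \<open>u \<in> U\<close> that] UF[OF \<open>v \<in> U\<close> that] UH[OF \<open>u \<in> U\<close>] UH[OF \<open>v \<in> U\<close>] that F(2)
      by (simp add: subset_iff)
    then have "u \<odot> v \<in> U" using UH that by (simp add: U_def Fx_iff)
    then show "\<phi> (u \<odot> v) \<in> H" by (rule \<phi>H)
    show "\<phi> u \<odot> \<phi> v \<in> H" using \<phi>H that by simp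
    show "\<phi> (u \<odot> v) x = (\<phi> u \<odot> \<phi> v) x" if "x \<in> V" for x
      using that \<phi>H \<open>u \<in> U\<close> \<open>v \<in> U\<close> UH sV ss by (simp add: \<phi>_apply)
  qed
  have Uopen: "openin TH U" unfolding U_def by (rule openin_Fx[OF F])
  have cou: "compact_open_subgroup GH TH U"
    unfolding compact_open_subgroup_def
  proof (intro conjI)
    show "subgroup U GH" unfolding U_def by (rule subgroup_Fx[OF F(2)])
    have "F\<^sub>0 \<subseteq> F" by (auto simp: F_def F\<^sub>1_def)
    then show "compactin TH U" unfolding U_def by (rule compact_Fx_mono[OF F\<^sub>0(3) _ F(2)])
  qed (rule Uopen)
  have cont: "continuous_map (subtopology TH U) (subtopology TH U) \<phi>"
  proof (rule continuous_map_into_subtopology)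
    show "continuous_map (subtopology TH U) TH \<phi>"
      unfolding continuous_map_def
    proof (intro conjI allI impI)
      show "\<phi> \<in> topspace (subtopology TH U) \<rightarrow> topspace TH" 
        using \<phi>H H_in_aut by auto
      fix S assume S: "openin TH S"
      have "openin TH {u \<in> U. \<phi> u \<in> S}"
        unfolding openin_TH
      proof (intro conjI ballI)
        show "{u \<in> U. \<phi> u \<in> S} \<subseteq> H" using UH by blast
        fix u assume u: "u \<in> {u \<in> U. \<phi> u \<in> S}"
        then obtain A where A: "finite A" "A \<subseteq> V" "{h \<in> H. \<forall>x\<in>A. h x = \<phi> u x} \<subseteq> S"
          using S unfolding openin_TH by blast
        \<comment> \<open>\<open>\<phi> h\<close> at \<open>x\<close> depends only on
          \<open>h\<close> at \<open>s x\<close>, and agreement with \<open>u\<close> on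
          \<open>F\<close> keeps \<open>h\<close> in \<open>U\<close>.\<close>
        have "{h \<in> H. \<forall>x\<in>s ` A \<union> F. h x = u x} \<subseteq> {u \<in> U. \<phi> u \<in> S}"
        proof
          fix h assume h: "h \<in> {h \<in> H. \<forall>x\<in>s ` A \<union> F. h x = u x}"
          then have hU: "h \<in> U" using u UF by (auto simp: U_def Fx_iff)
          moreover have "\<phi> h x = \<phi> u x" if "x \<in> A" for x
            using that h A(2) by (auto simp: \<phi>_apply subset_iff)
          ultimately show "h \<in> {u \<in> U. \<phi> u \<in> S}" using A(3) \<phi>H by auto
        qed
        moreover have "finite (s ` A \<union> F)" "s ` A \<union> F \<subseteq> V" using A F sV by auto
        ultimately show "\<exists>A. finite A \<and> A \<subseteq> V \<and> {h \<in> H. \<forall>x\<in>A. h x = u x} \<subseteq> {u \<in> U. \<phi> u \<in> S}"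
          by blast
      qed
      moreover have "{u \<in> topspace (subtopology TH U). \<phi> u \<in> S} = {u \<in> U. \<phi> u \<in> S}"
        using UH H_in_aut by auto
      ultimately show "openin (subtopology TH U) {u \<in> topspace (subtopology TH U). \<phi> u \<in> S}"
        using openin_open_subtopology[OF Uopen] by auto
    qed
    show "\<phi> \<in> topspace (subtopology TH U) \<rightarrow> U"
      using \<phi>U by auto
  qed
  have "homeomorphic_maps (subtopology TH U) (subtopology TH U) \<phi> \<phi>"
    unfolding homeomorphic_maps_def using cont \<phi>\<phi> by auto
  then have homeo: "homeomorphic_map (subtopology TH U) (subtopology TH U) \<phi>"
    using homeomorphic_map_maps by blast
  have "\<phi> \<in> hom (GH\<lparr>carrier := U\<rparr>) (GH\<lparr>carrier := U\<rparr>)"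
    using \<phi>U \<phi>mul by (auto simp: hom_def mul_def)
  moreover have "bij_betw \<phi> U U"
    by (rule bij_betw_byWitness[of _ \<phi>]) (use \<phi>\<phi> \<phi>U in auto)
  ultimately have "\<phi> \<in> iso (GH\<lparr>carrier := U\<rparr>) (GH\<lparr>carrier := U\<rparr>)" by (simp add: iso_def)
  with homeo have "topological_group_iso (GH\<lparr>carrier := U\<rparr>) (subtopology TH U)
      (GH\<lparr>carrier := U\<rparr>) (subtopology TH U) \<phi>"
    by (simp add: topological_group_iso_def)

  \<comment> \<open>Consequences of an extension to the whole group\<close>
  then obtain \<psi> where \<psi>: "\<psi> \<in> auto GH" "\<And>u. u \<in> U \<Longrightarrow> \<psi> u = \<phi> u"
    using rigid cou unfolding rigid_def by blast
  have \<psi>H: "\<psi> h \<in> H" if "h \<in> H" for h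
    using \<psi>(1) that by (auto simp: auto_def hom_def)
  have \<psi>mul: "\<psi> (h \<odot> k) = \<psi> h \<odot> \<psi> k" if "h \<in> H" "k \<in> H" for h k
    using \<psi>(1) that by (auto simp: auto_def hom_def mul_def)
  define r where "r = \<psi> g"
  have rH: "r \<in> H" using \<psi>H H by (simp add: r_def)
  \<comment> \<open>\<open>\<kappa>\<close> measures the failure of \<open>\<psi> g = s g s\<close>; it commutes with an open subgroup.\<close>
  define \<kappa> where "\<kappa> v = iv g (s (r (s v)))" for v
  have \<kappa>V: "\<kappa> v \<in> V" if "v \<in> V" for v using that sV rH H by (simp add: \<kappa>_def)
  have \<kappa>_inj: "\<kappa> v = \<kappa> w \<longleftrightarrow> v = w" if "v \<in> V" "w \<in> V" for v w
    using that sV rH H by (simp add: \<kappa>_def s_inj)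
  \<comment> \<open>Chosen so that for \<open>u\<close> in \<open>Fx F'\<close> both
    \<open>u\<close> and its conjugate by \<open>g\<close> lie in \<open>U\<close>, where the
    extension is known.\<close>
  define F' where "F' = F \<union> iv g ` F"
  have F': "finite F'" "F' \<subseteq> V" using F H by (auto simp: F'_def)
  have \<kappa>_comm: "u (\<kappa> v) = \<kappa> (u v)" if u: "u \<in> Fx F'" and v: "v \<in> V" for u v
  proof -
    have uH: "u \<in> H" using u by (simp add: Fx_iff)
    have uU: "u \<in> U" using u by (auto simp: U_def F'_def Fx_iff)
    define u' where "u' = g \<odot> u \<odot> iv g"
    have u'H: "u' \<in> H" using uH H by (simp add: u'_def)
    have u'_apply: "u' x = g (u (iv g x))" if "x \<in> V" for x using that uH H by (simp add: u'_def)
    have u'U: "u' \<in> U"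
      unfolding U_def Fx_iff using u'H u'_apply u F(2) H by (auto simp: F'_def Fx_iff subset_iff)
    \<comment> \<open>The extension turns this identity into one between \<open>\<phi> u'\<close>,
      \<open>r\<close> and \<open>\<phi> u\<close>. Evaluated at \<open>s v\<close>, and freed of
      the outer \<open>s\<close> and of \<open>g\<close>, it is the claim.\<close>
    have "u' \<odot> g = g \<odot> u" using u'H uH H by (intro H_ext) (simp_all add: u'_apply)
    then have "\<phi> u' \<odot> r = r \<odot> \<phi> u"
      using \<psi>mul[of u' g] \<psi>mul[of g u] \<psi>(2)[OF u'U] \<psi>(2)[OF uU] u'H uH H by (simp add: r_def)
    then have "(\<phi> u' \<odot> r) (s v) = (r \<odot> \<phi> u) (s v)" by simp
    then have "s (g (u (\<kappa> v))) = r (s (u v))"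
      using \<phi>H[OF u'U] \<phi>H[OF uU] rH sV[OF v] sV uH H v ss[OF v]
      by (simp add: \<phi>_apply u'_apply \<kappa>_def)
    then have "g (u (\<kappa> v)) = s (r (s (u v)))" using ss[of "g (u (\<kappa> v))"] \<kappa>V[OF v] uH H by simp
    then show ?thesis unfolding \<kappa>_def[of "u v"] using iv_apply(1)[OF H(3), of "u (\<kappa> v)"] \<kappa>V[OF v] uH by simp
  qed
  \<comment> \<open>Elements fixing \<open>F''\<close> have conjugates by \<gamma> and by \<alpha>
    that fix \<open>F'\<close>, hence commute with \<kappa>.\<close>
  define F'' where "F'' = iv \<gamma> ` F' \<union> iv \<alpha> ` F'"
  have F'': "finite F''" "F'' \<subseteq> V" using F' H by (auto simp: F''_def)
  \<comment> \<open>All that is known about \<open>\<kappa>\<close> is that it maps \<open>\<gamma> M\<close> and \<open>\<alpha> M\<close> into themselves; choosing a point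
    of \<open>M\<close> closest to \<open>q\<close> turns this into lower bounds for distances.\<close>
  define M where "M = {v \<in> V. \<exists>u\<in>Fx (F'' \<union> (V - c)). u v \<noteq> v}"
  have Mc: "M \<subseteq> c" by (auto simp: M_def Fx_iff)
  \<comment> \<open>Let a small \<open>u\<close> supported in \<open>c\<close> move
    \<open>w\<close>. Its conjugate by \<beta> moves \<open>\<beta> w\<close> and commutes with the
    injective map \<kappa>, so it moves \<open>\<kappa> (\<beta> w)\<close> too; pulled back by
    \<beta> this is a point moved by \<open>u\<close>.\<close>
  have \<kappa>M: "\<exists>w'\<in>M. \<kappa> (\<beta> w) = \<beta> w'" 
    if w: "w \<in> M" and \<beta>: "\<beta> \<in> H" "\<And>a. a \<in> F' \<Longrightarrow> iv \<beta> a \<in> F''" for w \<beta>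
  proof -
    obtain u where u: "u \<in> Fx (F'' \<union> (V - c))" "u w \<noteq> w" and wV: "w \<in> V" using w by (auto simp: M_def)
    have uH: "u \<in> H" using u by (simp add: Fx_iff)
    define u' where "u' = \<beta> \<odot> u \<odot> iv \<beta>"
    have u'_apply: "u' x = \<beta> (u (iv \<beta> x))" if "x \<in> V" for x using that uH \<beta> by (simp add: u'_def)
    have "u (iv \<beta> a) = iv \<beta> a" if "a \<in> F'" for a using u(1) \<beta>(2)[OF that] by (simp add: Fx_iff)
    then have u'F: "u' \<in> Fx F'"
      using uH \<beta>(1) F'(2) u'_apply by (auto simp: Fx_iff u'_def subset_iff)
    define w' where "w' = iv \<beta> (\<kappa> (\<beta> w))"
    have w'V: "w' \<in> V" using wV \<beta> \<kappa>V by (simp add: w'_def)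
    have w': "\<kappa> (\<beta> w) = \<beta> w'" using wV \<beta> \<kappa>V by (simp add: w'_def)
    have "u w' \<noteq> w'"
    proof
      assume "u w' = w'"
      then have "u' (\<kappa> (\<beta> w)) = \<kappa> (\<beta> w)" using w' w'V \<beta> u'_apply[of "\<beta> w'"] by simp
      then have "\<kappa> (u' (\<beta> w)) = \<kappa> (\<beta> w)" using \<kappa>_comm[OF u'F, of "\<beta> w"] wV \<beta> by simp
      then have "\<kappa> (\<beta> (u w)) = \<kappa> (\<beta> w)" using u'_apply[of "\<beta> w"] wV \<beta> by simp
      then show False using \<kappa>_inj[of "\<beta> (u w)" "\<beta> w"] wV \<beta> uH u(2) by simp
    qed
    then have "w' \<in> M" using u w'V by (auto simp: M_def)
    with w' show ?thesis by blast
  qed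
  have "M \<noteq> {}" using fat F'' unfolding fat_def M_def by blast
  then obtain w where w: "w \<in> M" and min: "\<And>v. v \<in> M \<Longrightarrow> dst w q \<le> dst v q"
    using ex_has_least_nat[of "\<lambda>w. w \<in> M" _ "\<lambda>w. dst w q"] by blast
  obtain w1 where w1: "w1 \<in> M" "\<kappa> (\<gamma> w) = \<gamma> w1" using \<kappa>M[OF w H(1)] by (auto simp: F''_def)
  obtain w2 where w2: "w2 \<in> M" "\<kappa> (\<alpha> w) = \<alpha> w2" using \<kappa>M[OF w H(2)] by (auto simp: F''_def)
  have c: "w \<in> c" "w1 \<in> c" "w2 \<in> c" using w w1 w2 Mc by auto
  then have V: "w \<in> V" "w1 \<in> V" "w2 \<in> V" using cV by auto
  have qc: "q \<in> c" using half_edge_end[OF E] by (simp add: c_def)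
  have not\<gamma>: "iv \<gamma> v \<notin> c" if "v \<in> V" "v \<notin> \<gamma> ` c" for v
    using that H by (metis imageI iv_apply(2))
  \<comment> \<open>As \<open>s\<close> sends \<open>\<gamma> w\<close> to \<open>w\<close>, the
    value of \<kappa> at \<open>\<gamma> w\<close> describes \<open>r w\<close>. The outer
    \<open>s\<close> disappears because \<open>g \<gamma> c\<close> avoids both swapped
    half-trees.\<close>
  have r\<gamma>: "r w = g (\<gamma> w1)"
  proof -
    have "s (\<gamma> w) = w" using ss[OF V(1)] sc[OF c(1)] by simp
    then have "iv g (s (r w)) = \<gamma> w1" using w1(2) by (simp add: \<kappa>_def)
    then have "s (r w) = g (\<gamma> w1)" using V sV rH H by (metis H_closed iv_apply(2))
    then have "r w = s (g (\<gamma> w1))" using ss[of "r w"] rH V by simp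
    moreover have "(g \<odot> \<gamma>) w1 \<notin> c" "(g \<odot> \<gamma>) w1 \<notin> \<gamma> ` c" using disj(4) c(2) by blast+
    then have "s (g (\<gamma> w1)) = g (\<gamma> w1)" using V H by (intro sid not\<gamma>) simp_all
    ultimately show ?thesis by simp
  qed
  have \<alpha>c: "\<alpha> v \<notin> c" "\<alpha> v \<notin> \<gamma> ` c" if "v \<in> c" for v using disj(2,3) that by blast+
  \<comment> \<open>Here \<open>s\<close> fixes \<open>\<alpha> w\<close>, so \<kappa> at
    \<open>\<alpha> w\<close> describes \<open>r\<close> at the same vertex.\<close>
  have r\<alpha>: "r (\<alpha> w) = g (\<alpha> w2)"
  proof -
    have "s (\<alpha> w) = \<alpha> w" using \<alpha>c[OF c(1)] V H by (intro sid not\<gamma>) simp_all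
    then have "iv g (s (r (\<alpha> w))) = \<alpha> w2" using w2(2) by (simp add: \<kappa>_def)
    then have "s (r (\<alpha> w)) = g (\<alpha> w2)" using V sV rH H by (metis H_closed iv_apply(2))
    then have "r (\<alpha> w) = s (g (\<alpha> w2))" using ss[of "r (\<alpha> w)"] rH V H by simp
    moreover have "(g \<odot> \<alpha>) w2 \<notin> c" "(g \<odot> \<alpha>) w2 \<notin> \<gamma> ` c" using disj(5) c(3) by blast+
    then have "s (g (\<alpha> w2)) = g (\<alpha> w2)" using V H by (intro sid not\<gamma>) simp_all
    ultimately show ?thesis by simp
  qed
  have root: "dst (\<beta> v) z = dst v q + dst (\<beta> q) z" 
    if "\<beta> \<in> H" "v \<in> c" "z \<in> V" "z \<notin> \<beta> ` c" for \<beta> v z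
  proof -
    have "\<beta> v \<in> hf (\<beta> p) (\<beta> q)" "z \<notin> hf (\<beta> p) (\<beta> q)"
      using image_half[OF that(1) pq] that by (auto simp: c_def)
    then show ?thesis using dst_via_root[OF H_adj[OF that(1) E]] that cV pq by auto
  qed

  \<comment> \<open>Comparison of distances through the roots of the half-trees\<close>
  have "dst w (\<alpha> w) = dst w q + dst q (\<alpha> w)"
    using dst_via_root[OF E, of w "\<alpha> w"] c \<alpha>c V H by (auto simp: c_def)
  also have "dst q (\<alpha> w) = dst w q + dst q (\<alpha> q)"
    using root[OF H(2) c(1) pq(2)] disj(2) qc pq V H dst_commute by auto
  finally have d1: "dst w (\<alpha> w) = 2 * dst w q + dst q (\<alpha> q)" by simp
  have "dst (\<gamma> w1) (\<alpha> w2) = dst w1 q + dst (\<gamma> q) (\<alpha> w2)"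
    using root[OF H(1) c(2)] \<alpha>c[OF c(3)] V H by simp
  also have "dst (\<gamma> q) (\<alpha> w2) = dst w2 q + dst (\<gamma> q) (\<alpha> q)"
    using root[OF H(2) c(3), of "\<gamma> q"] disj(3) qc pq V H dst_commute by auto
  finally have d2: "dst (\<gamma> w1) (\<alpha> w2) \<ge> 2 * dst w q + dst (\<gamma> q) (\<alpha> q)"
    using min[OF w1(1)] min[OF w2(1)] by simp
  \<comment> \<open>\<open>r\<close> and \<open>g\<close> are isometries, so the exact distance
    \<open>d1\<close> equals the one bounded below in \<open>d2\<close>. The depths cancel because
    \<open>w\<close> has minimal depth, and \<open>dist\<close> is contradicted.\<close>
  have "dst w (\<alpha> w) = dst (r w) (r (\<alpha> w))" using rH V H by simp
  also have "\<dots> = dst (\<gamma> w1) (\<alpha> w2)" using r\<gamma> r\<alpha> V H by simp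
  finally show False using d1 d2 dist by simp
qed

end

section \<open>Translations\<close>

context tree_group
begin

lemma orbit_mem: "\<lbrakk>g \<in> H; v \<in> V; w \<in> (\<lambda>g. g v) ` H\<rbrakk> \<Longrightarrow> g w \<in> (\<lambda>g. g v) ` H"
  by (metis (no_types, lifting) image_iff mul_apply mul_closed)

text \<open>Since \<open>u\<close> fixes \<open>x\<close>, the edge and its image point away from
  \<open>x\<close> and start equally far from it, as \<open>half_disjoint_or_eq\<close>
  requires.\<close>

lemma disjoint_image_half:
  assumes u: "u \<in> H" "u x = x" and x: "x \<in> V" "x \<notin> hf a b" and E: "E a b"
    and ne: "\<not> (u a = a \<and> u b = b)"
  shows "hf (u a) (u b) \<inter> hf a b = {}"
proof -
  have V: "a \<in> V" "b \<in> V" using E adj_in_verts by auto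
  have "x \<notin> hf (u a) (u b)" using H_half_mem[OF u(1) V x(1)] u(2) x(2) by simp
  moreover have "dst x a = dst x (u a)" using H_dst[OF u(1) x(1) V(1)] u(2) by simp
  ultimately show ?thesis
    using half_disjoint_or_eq[OF E H_adj[OF u(1) E] x(1,2)] ne by blast
qed

text \<open>If the edge were moved, then, seen from the fixed vertex \<open>a\<close>, its half-tree
  would be disjoint from its image; but both contain the fixed vertex \<open>b'\<close>.\<close>

lemma fixes_edge_between:
  assumes u: "u \<in> H" "u a = a" "u b' = b'" and E: "E a b" "E c d" "E a' b'"
    and sub: "hf a' b' \<subseteq> hf c d" "hf c d \<subseteq> hf a b"
  shows "u c = c \<and> u d = d"
proof (rule ccontr)
  assume "\<not> (u c = c \<and> u d = d)"
  then have "hf (u c) (u d) \<inter> hf c d = {}"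
    using disjoint_image_half[OF u(1,2) _ _ E(2)] sub(2) half_edge_end[OF E(1)] adj_in_verts[OF E(1)] by blast
  moreover have "b' \<in> hf c d" using sub(1) half_edge_end[OF E(3)] by blast
  moreover have "b' \<in> hf (u c) (u d)"
    using H_half_mem[OF u(1), of c d b'] adj_in_verts E u(3) \<open>b' \<in> hf c d\<close> by simp
  ultimately show False by blast
qed

text \<open>Such an automorphism is hyperbolic, with an axis through the edge from \<open>x\<close>
  to \<open>y\<close>.\<close>

definition translates :: "('v \<Rightarrow> 'v) \<Rightarrow> 'v \<Rightarrow> 'v \<Rightarrow> bool" where
  "translates \<tau> x y \<longleftrightarrow> \<tau> \<in> H \<and> E x y \<and> hf (\<tau> x) (\<tau> y) \<subset> hf x y"

text \<open>The complement of the forward half-tree is written as a half-tree of the reversed edge,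
  which makes the strip symmetric under inverting \<tau> and exchanging \<open>x\<close> and
  \<open>y\<close>.\<close>

definition strip :: "('v \<Rightarrow> 'v) \<Rightarrow> 'v \<Rightarrow> 'v \<Rightarrow> nat \<Rightarrow> 'v set" where
  "strip \<tau> x y n = hf (pw \<tau> (- int n) x) (pw \<tau> (- int n) y) \<inter> hf (pw \<tau> (int n) y) (pw \<tau> (int n) x)"

text \<open>Complements reverse inclusions. This transfers results on positive powers to negative
  ones.\<close>

lemma translates_inv:
  assumes "translates \<tau> x y"
  shows "translates (iv \<tau>) y x"
proof -
  have \<tau>: "\<tau> \<in> H" and E: "E x y" and sub: "hf (\<tau> x) (\<tau> y) \<subset> hf x y"
    using assms by (auto simp: translates_def)
  have V: "x \<in> V" "y \<in> V" using E adj_in_verts by auto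
  have mem: "v \<in> hf (iv \<tau> y) (iv \<tau> x) \<longleftrightarrow> \<tau> v \<in> hf y x" if "v \<in> V" for v
    using H_half_mem[OF \<tau>, of "iv \<tau> y" "iv \<tau> x" v] that V \<tau> by simp
  have compl: "v \<in> hf y x \<longleftrightarrow> v \<notin> hf x y" if "v \<in> V" for v
    using half_compl[OF E] that by blast
  have "hf (iv \<tau> y) (iv \<tau> x) \<subseteq> hf y x"
  proof
    fix v assume v: "v \<in> hf (iv \<tau> y) (iv \<tau> x)"
    then have vV: "v \<in> V" using half_subset by blast
    then have "\<tau> v \<notin> hf x y" using mem compl v \<tau> by simp
    then have "\<tau> v \<notin> hf (\<tau> x) (\<tau> y)" using sub by blast
    then show "v \<in> hf y x" using compl[OF vV] vV V \<tau> by simp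
  qed
  moreover obtain z where z: "z \<in> hf x y" "z \<notin> hf (\<tau> x) (\<tau> y)" using sub by blast
  then have zV: "z \<in> V" using half_subset by blast
  have "iv \<tau> z \<in> hf y x" using z(2) compl[of "iv \<tau> z"] half_mem_iff[OF \<tau> V zV] zV \<tau> by simp
  moreover have "iv \<tau> z \<notin> hf (iv \<tau> y) (iv \<tau> x)" using mem[of "iv \<tau> z"] compl[OF zV] z(1) zV \<tau> by simp
  ultimately show ?thesis using \<tau> adj_sym[OF E] unfolding translates_def by auto
qed

lemma strip_inv: "\<tau> \<in> H \<Longrightarrow> strip (iv \<tau>) y x n = strip \<tau> x y n"
  by (simp add: strip_def pw_uminus Int_commute)

section \<open>The nested translates of a half-tree\<close>

context
  fixes \<tau> x y
  assumes T: "translates \<tau> x y"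
begin

abbreviation hk :: "int \<Rightarrow> 'v set" where "hk k \<equiv> hf (pw \<tau> k x) (pw \<tau> k y)"

lemma T_in: "\<tau> \<in> H" "E x y" "x \<in> V" "y \<in> V" "pw \<tau> k \<in> H" "E (pw \<tau> k x) (pw \<tau> k y)"
  using T adj_in_verts[of x y] H_adj[OF pw_closed] by (auto simp: translates_def)

lemma pw_mem_hk: "v \<in> V \<Longrightarrow> pw \<tau> j v \<in> hk (j + k) \<longleftrightarrow> v \<in> hk k"
  using H_half_mem[of "pw \<tau> j" "pw \<tau> k x" "pw \<tau> k y" v] T_in by (simp add: pw_add)

lemma hk_0: "hk 0 = hf x y"
  using T_in by simp

lemma hk_compl: "hf (pw \<tau> k y) (pw \<tau> k x) = V - hk k"
  using half_compl[OF T_in(6)] by simp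

lemma hk_mono: "i \<le> j \<Longrightarrow> hk j \<subseteq> hk i"
proof (induction j rule: int_ge_induct)
  case (step k)
  have "hk (k + 1) \<subseteq> hk k"
  proof
    fix v assume v: "v \<in> hk (k + 1)"
    then have vV: "v \<in> V" using half_subset by blast
    define w where "w = pw \<tau> (- k) v"
    have wV: "w \<in> V" using vV T_in by (simp add: w_def)
    have vw: "v = pw \<tau> k w" using vV T_in by (simp add: w_def)
    have "w \<in> hk 1" using v pw_mem_hk[OF wV, of k 1] vw by simp
    then have "w \<in> hk 0" using T T_in by (auto simp: translates_def)
    then show "v \<in> hk k" using pw_mem_hk[OF wV, of k 0] vw by simp
  qed
  with step show ?case by blast
qed simp

lemma in_strip_iff: "v \<in> strip \<tau> x y n \<longleftrightarrow> v \<in> hk (- int n) \<and> v \<notin> hk (int n)"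
  unfolding strip_def hk_compl using half_subset by blast

text \<open>The only neighbour of \<open>x\<close> in \<open>hf x y\<close> is \<open>y\<close>, so
  if \<tau> fixed \<open>x\<close>, it would fix \<open>y\<close> and the inclusion would not be
  proper.\<close>

lemma translation_moves: "\<tau> x \<noteq> x"
proof
  assume \<tau>x: "\<tau> x = x"
  have sub: "hf x (\<tau> y) \<subset> hf x y" using T \<tau>x by (auto simp: translates_def)
  have E: "E x (\<tau> y)" using H_adj[OF T_in(1,2)] \<tau>x by simp
  have "\<tau> y \<in> hf x y" using half_edge_end[OF E] sub by blast
  then have "\<tau> y = y" using half_crossing[OF T_in(2) adj_sym[OF E]] half_edge_end[OF T_in(2)] by blast
  with sub show False by simp
qed

text \<open>A vertex \<open>v\<close> of \<open>hk (n + 1)\<close> has distance at least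
  \<open>n\<close> from \<open>\<tau> x\<close> by induction, and its geodesic to \<open>x\<close>
  passes through \<open>\<tau> x\<close>, which differs from \<open>x\<close>.\<close>

lemma hk_depth: "\<lbrakk>v \<in> hk (int n)\<rbrakk> \<Longrightarrow> n \<le> dst x v"
proof (induction n arbitrary: v)
  case (Suc n)
  have vV: "v \<in> V" using Suc.prems half_subset by blast
  define w where "w = iv \<tau> v"
  have wV: "w \<in> V" and vw: "v = \<tau> w" using vV T_in by (simp_all add: w_def)
  have "w \<in> hk (int n)"
    using pw_mem_hk[OF wV, of 1 "int n"] Suc.prems vw T_in by simp
  then have "n \<le> dst x w" by (rule Suc.IH)
  then have 1: "n \<le> dst v (\<tau> x)" using vw wV T_in dst_commute by simp
  have v1: "v \<in> hf (\<tau> x) (\<tau> y)" using Suc.prems hk_mono[of 1 "int (Suc n)"] T_in by auto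
  have "x \<notin> hf (\<tau> x) (\<tau> y)" using T half_edge_end[OF T_in(2)] by (auto simp: translates_def)
  then have "dst v x = dst v (\<tau> y) + 1 + dst (\<tau> x) x"
    using dst_across_edge[OF H_adj[OF T_in(1,2)] v1] T_in by blast
  moreover have "dst v (\<tau> x) = dst v (\<tau> y) + 1"
    using in_half_iff[OF H_adj[OF T_in(1,2)] vV] v1 by simp
  moreover have "0 < dst (\<tau> x) x" using translation_moves T_in by (intro gr0I) simp
  ultimately have "Suc n \<le> dst v x" using 1 by linarith
  then show ?case using dst_commute vV T_in by simp
qed simp

lemma finite_avoids_hk:
  assumes "finite F" "F \<subseteq> V"
  obtains N :: nat where "F \<inter> hk (int N) = {}"
proof -
  \<comment> \<open>The sum of all distances from \<open>x\<close> bounds each of them, so one index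
    serves for all of \<open>F\<close>.\<close>
  have "v \<notin> hk (int (Suc (\<Sum>v\<in>F. dst x v)))" if "v \<in> F" for v
    using hk_depth[of v "Suc (\<Sum>v\<in>F. dst x v)"] member_le_sum[OF that _ assms(1), of "dst x"] by auto
  then show thesis using that by blast
qed

end

lemma finite_in_hk:
  assumes T: "translates \<tau> x y" and F: "finite F" "F \<subseteq> V"
  obtains N :: nat where "F \<subseteq> hf (pw \<tau> (- int N) x) (pw \<tau> (- int N) y)"
proof -
  obtain N :: nat where "F \<inter> hf (pw (iv \<tau>) (int N) y) (pw (iv \<tau>) (int N) x) = {}"
    using finite_avoids_hk[OF translates_inv[OF T] F] by blast
  then have "F \<inter> (V - hf (pw \<tau> (- int N) x) (pw \<tau> (- int N) y)) = {}"
    using hk_compl[OF T, of "- int N"] T_in(1)[OF T] by (simp add: pw_uminus)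
  then show thesis using that F(2) by blast
qed

end

section \<open>Fat half-trees and half-trees inside strips\<close>

context tits_tree_group
begin

lemma fat_image:
  assumes "fat (hf a b)" "g \<in> H" "a \<in> V" "b \<in> V"
  shows "fat (hf (g a) (g b))"
  unfolding fat_def
proof (intro allI impI)
  fix F assume F: "finite F \<and> F \<subseteq> V"
  then have "finite (iv g ` F)" "iv g ` F \<subseteq> V" using assms by auto
  then obtain u v where u: "u \<in> Fx (iv g ` F \<union> (V - hf a b))" and v: "v \<in> V" "u v \<noteq> v"
    using assms(1) unfolding fat_def by blast
  have uH: "u \<in> H" using u by (simp add: Fx_iff)
  have app: "(g \<odot> u \<odot> iv g) w = g (u (iv g w))" if "w \<in> V" for w using that uH assms by simp
  have "(g \<odot> u \<odot> iv g) w = w" if "w \<in> F \<union> (V - hf (g a) (g b))" for w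
  proof -
    have wV: "w \<in> V" using that F by blast
    have "iv g w \<in> iv g ` F \<union> (V - hf a b)"
      using that half_mem_iff[OF assms(2-4) wV] wV assms by auto
    then have "u (iv g w) = iv g w" using u unfolding Fx_iff by blast
    then show ?thesis using app[OF wV] wV assms by simp
  qed
  then have "g \<odot> u \<odot> iv g \<in> Fx (F \<union> (V - hf (g a) (g b)))" using uH assms by (simp add: Fx_iff)
  moreover have "(g \<odot> u \<odot> iv g) (g v) \<noteq> g v" using app[of "g v"] v uH assms by simp
  ultimately show "\<exists>u\<in>Fx (F \<union> (V - hf (g a) (g b))). \<exists>v\<in>V. u v \<noteq> v"
    using H_closed[OF assms(2) v(1)] by blast
qed

text \<open>If the backward half-tree is not fat, then an element fixing some \<open>hk j\<close>
  pointwise is trivial (\<open>a\<close>), so fixators of translated edges act only in front of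
  these edges (\<open>b\<close>), and the stabiliser of \<open>x\<close> fixes all forward edges
  (\<open>c\<close>). An element fixing \<open>x\<close> and \<open>y\<close> then fixes every
  vertex, against non-discreteness.\<close>

lemma fat_backward_half:
  assumes T: "translates \<tau> x y"
  shows "fat (hf y x)"
proof (rule ccontr)
  note T_in = T_in[OF T] and hk_mono = hk_mono[OF T] and hk_compl = hk_compl[OF T] 
    and pw_mem = pw_mem_hk[OF T] and hk_0 = hk_0[OF T]
  assume "\<not> fat (hf y x)"
  then obtain F where F: "finite F" "F \<subseteq> V"
    and triv: "\<And>u v. \<lbrakk>u \<in> Fx (F \<union> (V - hf y x)); v \<in> V\<rbrakk> \<Longrightarrow> u v = v"
    unfolding fat_def by blast
  obtain M :: nat where M: "F \<subseteq> hk \<tau> x y (- int M)" using finite_in_hk[OF T F] by blast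
  have a: "u v = v" if u: "u \<in> H" "\<And>w. w \<in> hk \<tau> x y j \<Longrightarrow> u w = w" and v: "v \<in> V" for u j v
  proof -
    \<comment> \<open>Conjugation by this power carries \<open>hk j\<close> to
      \<open>hk (- M)\<close>, which contains \<open>F\<close> and the complement of
      \<open>hf y x\<close>.\<close>
    define k where "k = j + int M"
    define u' where "u' = pw \<tau> (- k) \<odot> u \<odot> pw \<tau> k"
    have u'H: "u' \<in> H" using u T_in by (simp add: u'_def)
    have app: "u' w = pw \<tau> (- k) (u (pw \<tau> k w))" if "w \<in> V" for w
      using that u T_in by (simp add: u'_def)
    have "u' w = w" if w: "w \<in> F \<union> (V - hf y x)" for w
    proof -
      have wV: "w \<in> V" using w F by blast
      have "w \<in> hk \<tau> x y (- int M)"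
        using w M hk_mono[of "- int M" 0] hk_0 half_compl[OF T_in(2)] half_subset by auto
      then have "pw \<tau> k w \<in> hk \<tau> x y j" using pw_mem[OF wV, of k "- int M"] by (simp add: k_def)
      then show ?thesis using u(2) app[OF wV] wV T_in by simp
    qed
    then have "u' \<in> Fx (F \<union> (V - hf y x))" using u'H by (simp add: Fx_iff)
    then have "u' (pw \<tau> (- k) v) = pw \<tau> (- k) v" using triv v T_in by simp
    then show ?thesis using app[of "pw \<tau> (- k) v"] u v T_in by simp
  qed
  have b: "u v = v" if u: "u \<in> H" "u (pw \<tau> j x) = pw \<tau> j x" "u (pw \<tau> j y) = pw \<tau> j y"
    and v: "v \<in> V" "v \<notin> hk \<tau> x y j" for u j v
  proof -
    have "u \<in> Fx {pw \<tau> j y, pw \<tau> j x}" using u by (simp add: Fx_iff)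
    then obtain w where w: "w \<in> Fx {pw \<tau> j y, pw \<tau> j x}"
      "\<And>v. v \<in> hf (pw \<tau> j y) (pw \<tau> j x) \<Longrightarrow> w v = u v" "\<And>v. v \<in> hk \<tau> x y j \<Longrightarrow> w v = v"
      using tits_edge[OF adj_sym[OF T_in(6)]] by blast
    have "w v = v" using a[of w j v] w v by (simp add: Fx_iff)
    then show ?thesis using w(2)[of v] hk_compl v by auto
  qed
  have c: "u (pw \<tau> (int n) x) = pw \<tau> (int n) x \<and> u (pw \<tau> (int n) y) = pw \<tau> (int n) y"
    if u: "u \<in> H" "u x = x" for u n
  proof (rule ccontr)
    define a' where "a' = pw \<tau> (int n) x"
    define b' where "b' = pw \<tau> (int n) y"
    assume "\<not> ?thesis"
    then have ne: "\<not> (u a' = a' \<and> u b' = b')" by (simp add: a'_def b'_def)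
    have V': "a' \<in> V" "b' \<in> V" using T_in by (auto simp: a'_def b'_def)
    have "x \<notin> hf a' b'"
      using hk_mono[of 0 "int n"] hk_0 half_edge_end[OF T_in(2)] by (auto simp: a'_def b'_def)
    then have disj: "hf (u a') (u b') \<inter> hf a' b' = {}"
      using disjoint_image_half[OF u T_in(3) _ _ ne] T_in(6) by (simp add: a'_def b'_def)
    \<comment> \<open>By \<open>b\<close> the support of \<open>v\<close> lies in the half-tree
      beyond \<open>b'\<close>. Conjugation by \<open>u\<close> moves it off that half-tree, so the
      conjugate is trivial by \<open>a\<close>, although \<open>v\<close> is not.\<close>
    obtain v z where v: "v \<in> Fx {a', b'}" and z: "z \<in> V" "v z \<noteq> z"
      using nondiscrete[of "{a', b'}"] V' by auto
    have vH: "v \<in> H" "v a' = a'" "v b' = b'" using v by (auto simp: Fx_iff)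
    have "(u \<odot> v \<odot> iv u) w = w" if w: "w \<in> hf a' b'" for w
    proof -
      have wV: "w \<in> V" using w half_subset by blast
      have "iv u w \<notin> hf a' b'" using disj w half_mem_iff[OF u(1) V' wV] by blast
      then have "v (iv u w) = iv u w" 
        using b[OF vH[unfolded a'_def b'_def], of "iv u w"] wV u by (simp add: a'_def b'_def)
      then show ?thesis using wV vH u by simp
    qed
    then have "(u \<odot> v \<odot> iv u) (u z) = u z"
      using a[of "u \<odot> v \<odot> iv u" "int n" "u z"] vH u z by (simp add: a'_def b'_def)
    then show False using vH u z by simp
  qed
  obtain u z where u: "u \<in> Fx {x, y}" and z: "z \<in> V" "u z \<noteq> z"
    using nondiscrete[of "{x, y}"] T_in by auto
  obtain N :: nat where N: "{z} \<inter> hk \<tau> x y (int N) = {}"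
    using finite_avoids_hk[OF T, of "{z}"] z by blast
  have "u z = z"
    using b[of u "int N" z] c[of u N] u z N by (simp add: Fx_iff)
  with z show False by simp
qed

text \<open>If the forward edge moved, its half-tree would go to one disjoint from it but still
  inside \<open>hf x y\<close>, that is, to a translate inside a strip.\<close>

lemma fixes_forward_edges:
  assumes T: "translates \<tau> x y"
    and no: "\<And>g n. g \<in> H \<Longrightarrow> \<not> hf (g x) (g y) \<subseteq> strip \<tau> x y n"
    and u: "u \<in> H" "u x = x" "u y = y"
  shows "u (pw \<tau> (int n) x) = pw \<tau> (int n) x \<and> u (pw \<tau> (int n) y) = pw \<tau> (int n) y"
proof (rule ccontr)
  note T_in = T_in[OF T] and hk_mono = hk_mono[OF T] and hk_0 = hk_0[OF T]
  let ?a = "pw \<tau> (int n) x"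
  let ?b = "pw \<tau> (int n) y"
  assume ne: "\<not> ?thesis"
  have "x \<notin> hf ?a ?b" using hk_mono[of 0 "int n"] hk_0 half_edge_end[OF T_in(2)] by auto
  then have disj: "hf (u ?a) (u ?b) \<inter> hf ?a ?b = {}"
    using disjoint_image_half[OF u(1,2) T_in(3) _ T_in(6) ne] by blast
  have "hf (u ?a) (u ?b) \<subseteq> hf x y"
  proof
    fix v assume v: "v \<in> hf (u ?a) (u ?b)"
    then have vV: "v \<in> V" using half_subset by blast
    have "iv u v \<in> hf ?a ?b" using half_mem_iff[OF u(1) _ _ vV, of ?a ?b] v T_in by simp
    then have "iv u v \<in> hf x y" using hk_mono[of 0 "int n"] hk_0 by auto
    then show "v \<in> hf x y" using half_mem_iff[OF u(1) T_in(3,4) vV] u by simp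
  qed
  also have "hf x y \<subseteq> hk \<tau> x y (- int n)" using hk_mono[of "- int n" 0] hk_0 by simp
  finally have "hf (u ?a) (u ?b) \<subseteq> strip \<tau> x y n"
    using disj in_strip_iff[OF T] by blast
  then show False using no[of "u \<odot> pw \<tau> (int n)" n] u T_in by simp
qed

lemma half_in_strip:
  assumes T: "translates \<tau> x y"
  shows "\<exists>g\<in>H. \<exists>n. hf (g x) (g y) \<subseteq> strip \<tau> x y n \<or> hf (g y) (g x) \<subseteq> strip \<tau> x y n"
proof (rule ccontr)
  note T_in = T_in[OF T] and hk_mono = hk_mono[OF T] and hk_compl = hk_compl[OF T] 
    and pw_mem = pw_mem_hk[OF T] and hk_0 = hk_0[OF T]
  assume nothesis: "\<not> ?thesis"
  have no: "\<not> hf (g x) (g y) \<subseteq> strip \<tau> x y n" "\<not> hf (g y) (g x) \<subseteq> strip \<tau> x y n" if "g \<in> H" for g n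
    using nothesis that by blast+
  have fix_all: "u (pw \<tau> j x) = pw \<tau> j x \<and> u (pw \<tau> j y) = pw \<tau> j y"
    if u: "u \<in> H" "u x = x" "u y = y" for u j
  proof (cases j rule: int_cases2)
    case (nonneg n)
    then show ?thesis using fixes_forward_edges[OF T no(1) u] by simp
  next
    case (nonpos n)
    have "u (pw (iv \<tau>) (int n) y) = pw (iv \<tau>) (int n) y \<and> u (pw (iv \<tau>) (int n) x) = pw (iv \<tau>) (int n) x"
      using u no(2) T_in by (intro fixes_forward_edges[OF translates_inv[OF T]]) (auto simp: strip_inv)
    then show ?thesis using nonpos T_in by (simp add: pw_uminus)
  qed
  \<comment> \<open>The converse of \<open>fix_all\<close>, obtained by conjugating with a power of
    \<tau>: fixing one translated edge forces fixing the original one.\<close>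
  have fix_back: "u x = x \<and> u y = y"
    if u: "u \<in> H" "u (pw \<tau> j x) = pw \<tau> j x" "u (pw \<tau> j y) = pw \<tau> j y" for u j
  proof -
    define u' where "u' = pw \<tau> (- j) \<odot> u \<odot> pw \<tau> j"
    have u': "u' \<in> H" "u' x = x" "u' y = y" using u T_in by (simp_all add: u'_def)
    have "u' (pw \<tau> (- j) x) = pw \<tau> (- j) x" "u' (pw \<tau> (- j) y) = pw \<tau> (- j) y"
      using fix_all[OF u'] by auto
    then have "pw \<tau> (- j) (u x) = pw \<tau> (- j) x" "pw \<tau> (- j) (u y) = pw \<tau> (- j) y"
      using u T_in by (simp_all add: u'_def)
    then show ?thesis using u T_in by simp
  qed
  \<comment> \<open>It suffices that \<open>u\<close> fixes the edge from \<open>A\<close> to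
    \<open>B\<close>, the image under \<open>g\<close> of a translated edge: the conjugate of
    \<open>u\<close> by the inverse of \<open>g\<close> then fixes the latter, and
    \<open>fix_back\<close> applies.\<close>
  have normal: "u (g x) = g x \<and> u (g y) = g y" if g: "g \<in> H" and u: "u \<in> H" "u x = x" "u y = y" for g u
  proof -
    obtain n :: nat where n: "{iv g x, iv g y} \<inter> hk \<tau> x y (int n) = {}"
      using finite_avoids_hk[OF T, of "{iv g x, iv g y}"] g T_in by auto
    define A where "A = g (pw \<tau> (int n) x)"
    define B where "B = g (pw \<tau> (int n) y)"
    have E: "E A B" unfolding A_def B_def by (rule H_adj[OF g T_in(6)])
    have V: "A \<in> V" "B \<in> V" using E adj_in_verts by auto
    have noAB: "\<not> hf A B \<subseteq> strip \<tau> x y m" for m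
      using no(1)[of "g \<odot> pw \<tau> (int n)" m] g T_in by (simp add: A_def B_def)
    have pV: "pw \<tau> (int n) x \<in> V" "pw \<tau> (int n) y \<in> V" using T_in by simp_all
    have "x \<notin> hf A B" "y \<notin> hf A B"
      unfolding A_def B_def half_mem_iff[OF g pV T_in(3)] half_mem_iff[OF g pV T_in(4)]
      using n by blast+
    then have "hf A B \<subseteq> hf x y \<or> hf A B \<subseteq> hf y x"
      by (rule half_subset_or_subset_compl[OF E T_in(2)])
    then have AB: "u A = A \<and> u B = B"
    proof
      assume sub: "hf A B \<subseteq> hf x y"
      \<comment> \<open>Not being contained in the strip, \<open>hf A B\<close> meets
        \<open>hk m\<close>. As \<open>A\<close> and \<open>B\<close> lie outside
        \<open>hk m\<close>, it contains \<open>hk m\<close>, and the edge is caught between two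
        fixed edges. The other case is the mirror image.\<close>
      obtain m :: nat where m: "{A, B} \<inter> hk \<tau> x y (int m) = {}"
        using finite_avoids_hk[OF T, of "{A, B}"] V by auto
      obtain z where z: "z \<in> hf A B" "z \<notin> strip \<tau> x y m" using noAB[of m] by blast
      have "z \<in> hk \<tau> x y (- int m)" using z(1) sub hk_mono[of "- int m" 0] hk_0 by auto
      then have "z \<in> hk \<tau> x y (int m)" using z(2) in_strip_iff[OF T] by blast
      moreover have "hk \<tau> x y (int m) \<subseteq> hf A B \<or> hk \<tau> x y (int m) \<subseteq> hf B A"
        using m by (intro half_subset_or_subset_compl[OF T_in(6) E]) auto
      ultimately have "hk \<tau> x y (int m) \<subseteq> hf A B" using z(1) half_compl[OF E] by blast
      then show ?thesis
        using fixes_edge_between[OF u(1,2) _ T_in(2) E T_in(6)] sub fix_all[OF u] by blast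
    next
      assume sub: "hf A B \<subseteq> hf y x"
      obtain m :: nat where m: "{A, B} \<subseteq> hk \<tau> x y (- int m)"
        using finite_in_hk[OF T, of "{A, B}"] V by auto
      have "hf A B \<inter> hk \<tau> x y (int m) = {}"
        using sub hk_mono[of 0 "int m"] hk_0 half_compl[OF T_in(2)] by auto
      then obtain z where z: "z \<in> hf A B" "z \<notin> hk \<tau> x y (- int m)"
        using noAB[of m] in_strip_iff[OF T] by blast
      have "z \<in> hf (pw \<tau> (- int m) y) (pw \<tau> (- int m) x)"
        unfolding hk_compl using z half_subset by blast
      moreover have "hf (pw \<tau> (- int m) y) (pw \<tau> (- int m) x) \<subseteq> hf A B \<or>
          hf (pw \<tau> (- int m) y) (pw \<tau> (- int m) x) \<subseteq> hf B A"
        using m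
        by (intro half_subset_or_subset_compl[OF adj_sym[OF T_in(6)] E]) (auto simp: hk_compl)
      ultimately have "hf (pw \<tau> (- int m) y) (pw \<tau> (- int m) x) \<subseteq> hf A B" 
        using z(1) half_compl[OF E] by blast
      then show ?thesis
        using fixes_edge_between[OF u(1,3) _ adj_sym[OF T_in(2)] E adj_sym[OF T_in(6)]] sub fix_all[OF u]
        by blast
    qed
    define u' where "u' = iv g \<odot> u \<odot> g"
    have u': "u' \<in> H" "u' (pw \<tau> (int n) x) = pw \<tau> (int n) x" "u' (pw \<tau> (int n) y) = pw \<tau> (int n) y"
      using AB u g T_in by (simp_all add: u'_def A_def B_def)
    have app: "u (g w) = g (u' w)" if "w \<in> V" for w using that u g by (simp add: u'_def)
    show ?thesis using fix_back[OF u'] app T_in by simp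
  qed
  have "Fx {x, y} = H"
    using normal T_in by (intro Fx_normal_imp_all) (auto simp: Fx_iff)
  then have "\<tau> x = x" using T_in(1) by (auto simp: Fx_iff)
  then show False using translation_moves[OF T] by simp
qed

lemma not_rigid_of_translates:
  assumes T: "translates \<tau> x y"
  shows "\<not> rigid GH TH"
proof -
  note T_in = T_in[OF T] and hk_mono = hk_mono[OF T] and hk_compl = hk_compl[OF T] 
    and pw_mem = pw_mem_hk[OF T] and hk_0 = hk_0[OF T]
  have fat: "fat (hf y x)" "fat (hf x y)"
    using fat_backward_half[OF T] fat_backward_half[OF translates_inv[OF T]] by auto
  obtain g n where g: "g \<in> H" "hf (g x) (g y) \<subseteq> strip \<tau> x y n \<or> hf (g y) (g x) \<subseteq> strip \<tau> x y n"
    using half_in_strip[OF T] by blast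
  obtain p q where E: "E p q" and fat: "fat (hf p q)" and sub: "hf p q \<subseteq> strip \<tau> x y n"
    using g(2) H_adj[OF g(1) T_in(2)] adj_sym fat fat_image[OF _ g(1)] T_in by metis
  define c where "c = hf p q"
  have q: "q \<in> c" "q \<in> V" using half_edge_end[OF E] adj_in_verts[OF E] by (auto simp: c_def)
  have cV: "c \<subseteq> V" unfolding c_def by (rule half_subset)
  have strip: "v \<in> hk \<tau> x y (- int n)" "v \<notin> hk \<tau> x y (int n)" if "v \<in> c" for v
    using that sub in_strip_iff[OF T] unfolding c_def by blast+
  \<comment> \<open>\<open>c\<close> lies between the levels \<open>- n\<close> and
    \<open>n\<close>, so a shift by \<open>2 * n\<close> carries it past level
    \<open>n\<close>.\<close>
  have far: "pw \<tau> k v \<notin> c" if "v \<in> c" "2 * int n \<le> k" for k v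
  proof
    assume kc: "pw \<tau> k v \<in> c"
    have "pw \<tau> k v \<in> hk \<tau> x y (k + - int n)" using pw_mem[of v k "- int n"] strip(1)[OF that(1)] that(1) cV by blast
    then have "pw \<tau> k v \<in> hk \<tau> x y (int n)" using hk_mono[of "int n" "k + - int n"] that(2) by auto
    with strip(2)[OF kc] show False by blast
  qed
  have disj: "pw \<tau> i ` c \<inter> pw \<tau> j ` c = {}" if "2 * int n \<le> i - j" for i j
  proof (rule ccontr)
    assume "pw \<tau> i ` c \<inter> pw \<tau> j ` c \<noteq> {}"
    then obtain w v where vw: "v \<in> c" "w \<in> c" "pw \<tau> i w = pw \<tau> j v" by blast
    have V: "v \<in> V" "w \<in> V" using vw cV by auto
    have "pw \<tau> j v = pw \<tau> j (pw \<tau> (i - j) w)"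
      using vw(3) pw_add[OF T_in(1) V(2), of j "i - j"] by simp
    then have "v = pw \<tau> (i - j) w" using H_inj V T_in by simp
    then show False using far[OF vw(2) that] vw(1) by simp
  qed
  \<comment> \<open>The powers \<open>a\<close>, \<open>m\<close>, \<open>N\<close> of \<tau> serve
    as \<alpha>, \<gamma> and \<open>g\<close>. All relevant exponents differ by at least
    \<open>2 * n\<close>, and by \<open>hk_depth\<close> the terms in \<open>m\<close> push its
    translate of \<open>q\<close> far enough from that of \<open>a\<close>.\<close>
  define a where "a = 2 * int n"
  define m where "m = 5 * int n + int (dst q (pw \<tau> a q)) + int (dst x (pw \<tau> a q)) + 1"
  define N where "N = m + 2 * int n"
  have zero: "pw \<tau> 0 ` c = c" using cV by force
  have comp: "(pw \<tau> i \<odot> pw \<tau> j) ` c = pw \<tau> (i + j) ` c" for i j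
    using cV T_in by (intro image_cong) (auto simp: pw_add)
  have "dst q (pw \<tau> a q) < dst (pw \<tau> m q) (pw \<tau> a q)"
  proof -
    define k where "k = nat (m - int n)"
    have k: "int k = m + - int n" by (simp add: k_def m_def)
    have "pw \<tau> m q \<in> hk \<tau> x y (int k)" unfolding k using pw_mem[OF q(2)] strip(1)[OF q(1)] by blast
    then have "k \<le> dst x (pw \<tau> m q)" by (rule hk_depth[OF T])
    also have "\<dots> \<le> dst x (pw \<tau> a q) + dst (pw \<tau> m q) (pw \<tau> a q)"
      using dst_triangle[of x "pw \<tau> a q" "pw \<tau> m q"] dst_commute q(2) T_in by simp
    finally show ?thesis using k by (simp add: m_def)
  qed
  moreover have "c \<inter> pw \<tau> m ` c = {}" using disj[of m 0] unfolding zero by (simp add: m_def Int_commute)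
  moreover have "c \<inter> pw \<tau> a ` c = {}" using disj[of a 0] unfolding zero by (simp add: a_def Int_commute)
  moreover have "pw \<tau> m ` c \<inter> pw \<tau> a ` c = {}"
    using disj[of m a] by (simp add: a_def m_def Int_commute)
  moreover have "(pw \<tau> N \<odot> pw \<tau> m) ` c \<inter> (c \<union> pw \<tau> m ` c) = {}"
    using disj[of "N + m" 0] disj[of "N + m" m] unfolding comp zero Int_Un_distrib
    by (simp add: m_def N_def)
  moreover have "(pw \<tau> N \<odot> pw \<tau> a) ` c \<inter> (c \<union> pw \<tau> m ` c) = {}"
    using disj[of "N + a" 0] disj[of "N + a" m] unfolding comp zero Int_Un_distrib
    by (simp add: a_def m_def N_def)
  ultimately show ?thesis
    by (intro not_rigid_of_disjoint_translates[OF E fat T_in(5) T_in(5) T_in(5), of m a N]) 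
      (simp_all only: c_def)
qed

section \<open>Existence of a translation\<close>

lemma infinite_orbit:
  assumes v: "v \<in> V"
  shows "infinite ((\<lambda>g. g v) ` H)"
proof
  \<comment> \<open>The fixator of a finite orbit satisfies the invariance condition and is
    therefore the whole group: finite orbits are fixed points.\<close>
  have fixed: "g w = w" if w: "w \<in> V" "finite ((\<lambda>g. g w) ` H)" and g: "g \<in> H" for g w
  proof -
    have "Fx ((\<lambda>g. g w) ` H) = H"
    proof (rule Fx_normal_imp_all[OF w(2)])
      show "(\<lambda>g. g w) ` H \<subseteq> V" using w by auto
      show "u (g a) = g a" if "g \<in> H" "u \<in> Fx ((\<lambda>g. g w) ` H)" "a \<in> (\<lambda>g. g w) ` H" for g u a
        using that(2) orbit_mem[OF that(1) w(1) that(3)] unfolding Fx_iff by blast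
    qed
    then have "g \<in> Fx ((\<lambda>g. g w) ` H)" using g by simp
    then have "g (idn w) = idn w" by (simp add: Fx_iff)
    then show ?thesis using w by simp
  qed
  assume fin: "finite ((\<lambda>g. g v) ` H)"
  obtain g w where g: "g \<in> H" "w \<in> V" "g w \<noteq> w" using nontrivial by blast
  \<comment> \<open>If \<open>v\<close> is fixed, every orbit stays in a ball around
    \<open>v\<close>, so all orbits are finite and all vertices fixed.\<close>
  have "dst (h w) v \<le> dst w v" if "h \<in> H" for h
    using H_dst[OF that g(2) v] fixed[OF v fin that] by simp
  then have "(\<lambda>g. g w) ` H \<subseteq> {u \<in> V. dst u v \<le> dst w v}" using g by auto
  then have "finite ((\<lambda>g. g w) ` H)" using finite_ball[OF v] finite_subset by blast
  then show False using fixed g by blast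
qed

text \<open>Geodesics between points of an orbit stay within a union of finitely many orbits, so that
  a long one contains two oriented edges of the same orbit.\<close>

lemma obtain_translates:
  assumes cg: "compactly_generated GH TH"
  obtains \<tau> x y where "translates \<tau> x y"
proof -
  obtain K where K: "compactin TH K" "generate GH K = H"
    using cg by (auto simp: compactly_generated_def)
  have KH: "K \<subseteq> H" using compactin_subset_topspace[OF K(1)] by simp
  obtain v\<^sub>0 where o: "v\<^sub>0 \<in> V" using verts_nonempty by blast
  \<comment> \<open>Evaluation at \<open>v\<^sub>0\<close> is locally constant, hence takes finitely
    many values on a compact set.\<close>
  have "finite ((\<lambda>k. k v\<^sub>0) ` K)"
  proof -
    define U where "U z = {h \<in> H. \<forall>x\<in>{v\<^sub>0}. h x = z}" for z
    have op: "openin TH (U z)" for z unfolding U_def by (rule openin_agree) (use o in auto)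
    have "K \<subseteq> \<Union> (range U)" using KH by (auto simp: U_def)
    then obtain \<F> where \<F>: "finite \<F>" "\<F> \<subseteq> range U" "K \<subseteq> \<Union> \<F>"
      using K(1) op unfolding compactin_def by (metis rangeE)
    then obtain Z where "finite Z" "\<F> = U ` Z" by (meson finite_subset_image)
    moreover from this have "(\<lambda>k. k v\<^sub>0) ` K \<subseteq> Z" using \<F>(3) by (auto simp: U_def)
    ultimately show ?thesis using finite_subset by blast
  qed
  define P where "P = insert v\<^sub>0 {v \<in> V. \<exists>k\<in>K. dst v\<^sub>0 v + dst v (k v\<^sub>0) = dst v\<^sub>0 (k v\<^sub>0)}"
  have PV: "P \<subseteq> V" using o by (auto simp: P_def)
  have "P \<subseteq> insert v\<^sub>0 (\<Union>z\<in>(\<lambda>k. k v\<^sub>0) ` K. {v \<in> V. dst v v\<^sub>0 \<le> dst v\<^sub>0 z})"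
  proof
    fix v assume "v \<in> P"
    moreover have "dst v v\<^sub>0 \<le> dst v\<^sub>0 (k v\<^sub>0)" if "v \<in> V" "dst v\<^sub>0 v + dst v (k v\<^sub>0) = dst v\<^sub>0 (k v\<^sub>0)" for k
      using that dst_commute[OF that(1) o] by simp
    ultimately show "v \<in> insert v\<^sub>0 (\<Union>z\<in>(\<lambda>k. k v\<^sub>0) ` K. {v \<in> V. dst v v\<^sub>0 \<le> dst v\<^sub>0 z})"
      unfolding P_def by blast
  qed
  then have finP: "finite P"
    using \<open>finite ((\<lambda>k. k v\<^sub>0) ` K)\<close> finite_ball[OF o] by (meson finite.insertI finite_UN finite_subset)
  define X where "X = {w. \<exists>g\<in>H. \<exists>v\<in>P. w = g v}"
  have Xinv: "v \<in> X" if gv: "g \<in> H" "v \<in> V" "g v \<in> X" for g v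
  proof -
    obtain h w where hw: "h \<in> H" "w \<in> P" "g v = h w" using gv(3) by (auto simp: X_def)
    then have "v = (iv g \<odot> h) w" using gv PV by (metis iv_apply(1) iv_closed mul_apply subsetD)
    moreover have "iv g \<odot> h \<in> H" using gv hw by simp
    ultimately show ?thesis using hw(2) unfolding X_def by blast
  qed
  have PX: "P \<subseteq> X"
  proof
    fix v assume "v \<in> P"
    moreover from this have "v = idn v" using PV by auto
    ultimately show "v \<in> X" unfolding X_def using idn_in_H by blast
  qed
  \<comment> \<open>Induction on words in the generators: the geodesic from \<open>v\<^sub>0\<close>
    to \<open>h1 (h2 v\<^sub>0)\<close> is covered by the one to \<open>h1 v\<^sub>0\<close> and the
    \<open>h1\<close>-translate of the one from \<open>v\<^sub>0\<close> to
    \<open>h2 v\<^sub>0\<close>.\<close>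
  have seg: "\<forall>v\<in>V. dst v\<^sub>0 v + dst v (g v\<^sub>0) = dst v\<^sub>0 (g v\<^sub>0) \<longrightarrow> v \<in> X" if "g \<in> generate GH K" for g
    using that
  proof (induction g rule: generate.induct)
    case one
    show ?case unfolding idn_def[symmetric]
    proof (intro ballI impI)
      fix v assume v: "v \<in> V" "dst v\<^sub>0 v + dst v (idn v\<^sub>0) = dst v\<^sub>0 (idn v\<^sub>0)"
      have "dst v\<^sub>0 v = 0" using v(2) unfolding idn_apply[OF o] dst_self[OF o] by linarith
      then have "v\<^sub>0 = v" using dst_eq_0[OF o v(1)] by blast
      then show "v \<in> X" using PX by (auto simp: P_def)
    qed
  next
    case (incl h)
    show ?case
    proof (intro ballI impI)
      fix v assume "v \<in> V" "dst v\<^sub>0 v + dst v (h v\<^sub>0) = dst v\<^sub>0 (h v\<^sub>0)"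
      with incl have "v \<in> P" unfolding P_def by blast
      then show "v \<in> X" by (rule subsetD[OF PX])
    qed
  next
    case (inv h)
    show ?case unfolding iv_def[symmetric]
    proof (intro ballI impI)
      fix v assume v: "v \<in> V" "dst v\<^sub>0 v + dst v (iv h v\<^sub>0) = dst v\<^sub>0 (iv h v\<^sub>0)"
      have hH: "h \<in> H" using inv KH by blast
      have "dst (h v\<^sub>0) (h v) + dst (h v) v\<^sub>0 = dst (h v\<^sub>0) v\<^sub>0"
        using v H_dst[OF hH o v(1)] H_dst[OF hH v(1), of "iv h v\<^sub>0"] H_dst[OF hH o, of "iv h v\<^sub>0"] hH o by simp
      then have "dst v\<^sub>0 (h v) + dst (h v) (h v\<^sub>0) = dst v\<^sub>0 (h v\<^sub>0)"
        using dst_commute v o hH by simp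
      then have "h v \<in> P" unfolding P_def using inv v hH by auto
      then show "v \<in> X" using Xinv[OF hH v(1)] PX by blast
    qed
  next
    case (eng h1 h2)
    have H12: "h1 \<in> H" "h2 \<in> H" using eng K(2) by auto
    show ?case unfolding mul_def[symmetric]
    proof (intro ballI impI)
      fix v assume v: "v \<in> V" "dst v\<^sub>0 v + dst v ((h1 \<odot> h2) v\<^sub>0) = dst v\<^sub>0 ((h1 \<odot> h2) v\<^sub>0)"
      have "dst v\<^sub>0 v + dst v (h1 v\<^sub>0) = dst v\<^sub>0 (h1 v\<^sub>0) \<or>
          dst (h1 v\<^sub>0) v + dst v ((h1 \<odot> h2) v\<^sub>0) = dst (h1 v\<^sub>0) ((h1 \<odot> h2) v\<^sub>0)"
        using geodesic_subset_union[OF o _ _ v(1), of "h1 v\<^sub>0" "(h1 \<odot> h2) v\<^sub>0"] v(2) H12 o by simp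
      then show "v \<in> X"
      proof
        assume *: "dst (h1 v\<^sub>0) v + dst v ((h1 \<odot> h2) v\<^sub>0) = dst (h1 v\<^sub>0) ((h1 \<odot> h2) v\<^sub>0)"
        define w where "w = iv h1 v"
        have w: "w \<in> V" "v = h1 w" using v H12 by (simp_all add: w_def)
        have "dst v\<^sub>0 w + dst w (h2 v\<^sub>0) = dst v\<^sub>0 (h2 v\<^sub>0)" using * w H12 o by simp
        then have "w \<in> X" using eng w by blast
        then show ?thesis using Xinv[of "iv h1" v] v H12 by (simp add: w_def)
      qed (use eng v in blast)
    qed
  qed
  \<comment> \<open>Finitely many oriented edges such that every oriented edge on a geodesic from
    \<open>v\<^sub>0\<close> to a point of its orbit is a translate of one of them.\<close>
  define Q where "Q = Sigma P (\<lambda>v. {w. E v w})"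
  have finQ: "finite Q" unfolding Q_def using finP PV finite_neighbours by auto
  have "\<exists>g\<in>H. card Q < dst v\<^sub>0 (g v\<^sub>0)"
  proof (rule ccontr)
    assume "\<not> ?thesis"
    then have "dst (g v\<^sub>0) v\<^sub>0 \<le> card Q" if "g \<in> H" for g
      unfolding dst_commute[OF H_closed[OF that o] o] using that by (simp add: not_less)
    then have "(\<lambda>g. g v\<^sub>0) ` H \<subseteq> {v \<in> V. dst v v\<^sub>0 \<le> card Q}" using o by auto
    then show False using infinite_orbit[OF o] finite_ball[OF o] finite_subset by blast
  qed
  then obtain g where g: "g \<in> H" "card Q < dst v\<^sub>0 (g v\<^sub>0)" by blast
  define n where "n = dst v\<^sub>0 (g v\<^sub>0)"
  have gV: "g v\<^sub>0 \<in> V" using g o by simp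
  obtain z where z: "z 0 = v\<^sub>0" "z n = g v\<^sub>0" "\<And>i. i < n \<Longrightarrow> E (z i) (z (Suc i))"
    "\<And>i. i \<le> n \<Longrightarrow> z i \<in> V" "\<And>i j. i \<le> j \<Longrightarrow> j \<le> n \<Longrightarrow> dst (z i) (z j) = j - i"
    using geodesic[OF o gV] unfolding n_def by blast
  have "\<exists>h\<in>H. (iv h (z i), iv h (z (Suc i))) \<in> Q" if i: "i < n" for i
  proof -
    have "dst v\<^sub>0 (z i) + dst (z i) (g v\<^sub>0) = dst v\<^sub>0 (g v\<^sub>0)"
      using z(5)[of 0 i] z(5)[of i n] i z(1,2) by (simp add: n_def)
    then have "z i \<in> X" using seg g(1) K(2) z(4)[of i] i by auto
    then obtain h v where hv: "h \<in> H" "v \<in> P" "z i = h v" by (auto simp: X_def)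
    then have "v = iv h (z i)" using PV by auto
    moreover have "E (iv h (z i)) (iv h (z (Suc i)))" using H_adj[OF iv_closed[OF hv(1)] z(3)[OF i]] .
    ultimately have "(iv h (z i), iv h (z (Suc i))) \<in> Q" using hv(2) by (simp add: Q_def)
    then show ?thesis using hv(1) by blast
  qed
  then obtain c where c: "\<And>i. i < n \<Longrightarrow> c i \<in> H"
    "\<And>i. i < n \<Longrightarrow> (iv (c i) (z i), iv (c i) (z (Suc i))) \<in> Q" by metis
  define f where "f i = (iv (c i) (z i), iv (c i) (z (Suc i)))" for i
  have "card (f ` {..<n}) \<le> card Q"
    using c(2) by (intro card_mono[OF finQ]) (auto simp: f_def)
  then have "\<not> inj_on f {..<n}" using g(2) by (intro pigeonhole) (simp add: n_def)
  then obtain i j where ij: "i < n" "j < n" "f i = f j" "i < j"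
    unfolding inj_on_def by (metis lessThan_iff nat_neq_iff)
  \<comment> \<open>Carries the \<open>i\<close>-th oriented edge of the geodesic to the
    \<open>j\<close>-th. Both point in the direction of travel, so the half-trees are properly
    nested.\<close>
  define \<tau> where "\<tau> = c j \<odot> iv (c i)"
  have \<tau>H: "\<tau> \<in> H" using c(1) ij by (simp add: \<tau>_def)
  have V: "z i \<in> V" "z (Suc i) \<in> V" "z j \<in> V" "z (Suc j) \<in> V" using z(4) ij by auto
  have \<tau>z: "\<tau> (z i) = z j" "\<tau> (z (Suc i)) = z (Suc j)"
    using ij(3) c(1)[OF ij(1)] c(1)[OF ij(2)] V by (simp_all add: \<tau>_def f_def)
  have E: "E (z i) (z (Suc i))" "E (z j) (z (Suc j))" using z(3) ij by auto
  have "z i \<notin> hf (z j) (z (Suc j))"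
    using z(5)[of i j] z(5)[of i "Suc j"] ij by (simp add: half_def; arith)
  moreover have n1: "z (Suc i) \<notin> hf (z j) (z (Suc j))"
    using z(5)[of "Suc i" j] z(5)[of "Suc i" "Suc j"] ij by (simp add: half_def; arith)
  ultimately have "hf (z j) (z (Suc j)) \<subseteq> hf (z i) (z (Suc i)) \<or> hf (z j) (z (Suc j)) \<subseteq> hf (z (Suc i)) (z i)"
    by (rule half_subset_or_subset_compl[OF E(2,1)])
  moreover have "z (Suc j) \<in> hf (z i) (z (Suc i))"
    using z(5)[of i "Suc j"] z(5)[of "Suc i" "Suc j"] ij V
      dst_commute[OF V(4,1)] dst_commute[OF V(4,2)] by (simp add: half_def; arith)
  ultimately have "hf (z j) (z (Suc j)) \<subseteq> hf (z i) (z (Suc i))"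
    using half_edge_end[OF E(2)] half_compl[OF E(1)] by blast
  moreover have "z (Suc i) \<in> hf (z i) (z (Suc i))" using half_edge_end[OF E(1)] by simp
  ultimately have "translates \<tau> (z i) (z (Suc i))"
    using \<tau>H E(1) n1 \<tau>z unfolding translates_def by auto
  then show thesis by (rule that)
qed

end

theorem theorem2:
  fixes V :: "'v set" and E :: "'v \<Rightarrow> 'v \<Rightarrow> bool" and H :: "('v \<Rightarrow> 'v) set"
  assumes "locally_finite_tree V E"
    and "subgroup H (aut_group V E)"
    and "closedin (permutation_topology V E) H"
    and "class_S ((aut_group V E)\<lparr>carrier := H\<rparr>) (subtopology (permutation_topology V E) H)"
    and "compactly_generated ((aut_group V E)\<lparr>carrier := H\<rparr>)
           (subtopology (permutation_topology V E) H)"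
    and "tits_independence V E H"
  shows "\<not> rigid ((aut_group V E)\<lparr>carrier := H\<rparr>) (subtopology (permutation_topology V E) H)"
proof -
  interpret tits_tree_group V E H
    using assms by (simp add: tits_tree_group_def tree_group_def tree_group_axioms_def tits_tree_group_axioms_def)
  show ?thesis
    using obtain_translates[OF assms(5)] not_rigid_of_translates by blast
qed

end
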